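(* Let $\mathbb{Q}\mathbb{D}$ be the Fraïssé limit of the class of finite diversities whose diversity map takes only rational values. Then $\mathrm{Aut}(\mathbb{Q}\mathbb{D})$ is dissociated.
   Context: For a set $X$, $\mathcal{P}_{\mathrm{fin}}(X)$ is the set of finite subsets of $X$. A diversity is a couple $(X,\delta)$ where $\delta:\mathcal{P}_{\mathrm{fin}}(X)\to\mathbb{R}_+$ (the diversity map) satisfies: $\delta(A)=0$ if and only if $|A|\leq1$; and if $B\neq\emptyset$ then $\delta(A\cup C)\leq\delta(A\cup B)+\delta(B\cup C)$. Embeddings of diversities are injections preserving $\delta$ on all finite subsets. The class of finite diversities with rational-valued diversity map is a Fraïssé class; its Fraïssé limit $\mathbb{Q}\mathbb{D}$ is the unique (up to isomorphism) countable diversity with rational-valued diversity map into which every finite rational-valued diversity embeds and such that every isomorphism between finite sub-diversities extends to an automorphism. Let $\Omega$ be the countably infinite underlying set of $\mathbb{Q}\mathbb{D}$. $G=\mathrm{Aut}(\mathbb{Q}\mathbb{D})$ is the group of bijections of $\Omega$ preserving $\delta$, a closed subgroup of $\mathrm{Sym}(\Omega)$ with the topology of pointwise convergence ($\Omega$ discrete). For $A\subseteq\Omega$, $G_A$ is the pointwise stabilizer of $A$. A unitary representation of $G$ on a Hilbert space $\mathcal{H}$ is a homomorphism $\pi:G\to\mathcal{U}(\mathcal{H})$ with $g\mapsto\pi(g)\xi$ continuous for all $\xi$. It is dissociated if $p_Ap_B=p_{A\cap B}$ for all finite $A,B\subseteq\Omega$, where $p_A$ is the orthogonal projection onto $\mathcal{H}_A=\{\xi\in\mathcal{H}:\pi(g)\xi=\xi\text{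 for all }g\in G_A\}$. $G$ is dissociated if all of its unitary representations are dissociated. *)

theory Defs
  imports "HOL-Analysis.Analysis" "HOL-Algebra.Bij"
begin

section \<open>Diversities\<close>

text \<open>The diversity map is a function on all sets of the type; only its values on the finite
  subsets of the carrier matter.\<close>

definition diversity :: "'a set \<Rightarrow> ('a set \<Rightarrow> real) \<Rightarrow> bool" where
  "diversity X \<delta> \<longleftrightarrow>
     (\<forall>A. finite A \<and> A \<subseteq> X \<longrightarrow> 0 \<le> \<delta> A) \<and>
     (\<forall>A. finite A \<and> A \<subseteq> X \<longrightarrow> (\<delta> A = 0 \<longleftrightarrow> card A \<le> 1)) \<and>
     (\<forall>A B C. finite A \<and> A \<subseteq> X \<and> finite B \<and> B \<subseteq> X \<and> finite C \<and> C \<subseteq> X \<and> B \<noteq> {}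
        \<longrightarrow> \<delta> (A \<union> C) \<le> \<delta> (A \<union> B) + \<delta> (B \<union> C))"

definition rational_diversity :: "'a set \<Rightarrow> ('a set \<Rightarrow> real) \<Rightarrow> bool" where
  "rational_diversity X \<delta> \<longleftrightarrow> diversity X \<delta> \<and> (\<forall>A. finite A \<and> A \<subseteq> X \<longrightarrow> \<delta> A \<in> \<rat>)"

definition diversity_embedding ::
    "'a set \<Rightarrow> ('a set \<Rightarrow> real) \<Rightarrow> 'b set \<Rightarrow> ('b set \<Rightarrow> real) \<Rightarrow> ('a \<Rightarrow> 'b) \<Rightarrow> bool" where
  "diversity_embedding X \<delta> Y \<epsilon> f \<longleftrightarrow>
     f \<in> X \<rightarrow> Y \<and> inj_on f X \<and> (\<forall>A. finite A \<and> A \<subseteq> X \<longrightarrow> \<epsilon> (f ` A) = \<delta> A)"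

definition diversity_iso ::
    "'a set \<Rightarrow> ('a set \<Rightarrow> real) \<Rightarrow> 'b set \<Rightarrow> ('b set \<Rightarrow> real) \<Rightarrow> ('a \<Rightarrow> 'b) \<Rightarrow> bool" where
  "diversity_iso X \<delta> Y \<epsilon> f \<longleftrightarrow> diversity_embedding X \<delta> Y \<epsilon> f \<and> f ` X = Y"

text \<open>Automorphisms are extensional functions (equal to \<^term>\<open>undefined\<close> off the carrier), as
  in \<^const>\<open>BijGroup\<close>, so that they are determined by their restriction to the carrier.\<close>

definition diversity_Aut :: "'a set \<Rightarrow> ('a set \<Rightarrow> real) \<Rightarrow> ('a \<Rightarrow> 'a) monoid" where
  "diversity_Aut X \<delta> = (BijGroup X)\<lparr>carrier := {g \<in> Bij X. diversity_iso X \<delta> X \<delta> g}\<rparr>"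

lemma subgroup_diversity_Aut: "subgroup (carrier (diversity_Aut X \<delta>)) (BijGroup X)"
proof -
  interpret group "BijGroup X" by (rule group_BijGroup)
  let ?H = "{g \<in> Bij X. diversity_iso X \<delta> X \<delta> g}"
  have memI: "g \<in> ?H"
    if "g \<in> Bij X" "\<And>A. finite A \<Longrightarrow> A \<subseteq> X \<Longrightarrow> \<delta> (g ` A) = \<delta> A" for g
    using that by (auto simp: diversity_iso_def diversity_embedding_def Bij_def bij_betw_def)
  have "subgroup ?H (BijGroup X)"
  proof (rule subgroupI)
    show "?H \<subseteq> carrier (BijGroup X)" by (auto simp: BijGroup_def)
    have "(\<lambda>x\<in>X. x) \<in> ?H"
    proof -
      have "(\<lambda>x\<in>X. x) ` A = A" if "A \<subseteq> X" for A
        using that image_cong[of A A "\<lambda>x\<in>X. x" "\<lambda>x. x"] by auto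
      then show ?thesis by (intro memI id_Bij) simp
    qed
    then show "?H \<noteq> {}" by blast
  next
    fix g assume g: "g \<in> ?H"
    then have gB: "g \<in> Bij X" and bij: "bij_betw g X X"
      by (auto simp: Bij_def)
    have inv: "inv\<^bsub>BijGroup X\<^esub> g = (\<lambda>x\<in>X. inv_into X g x)"
      using gB by (rule inv_BijGroup)
    have iB: "(\<lambda>x\<in>X. inv_into X g x) \<in> Bij X"
      using gB by (rule restrict_inv_into_Bij)
    have "\<delta> ((\<lambda>x\<in>X. inv_into X g x) ` A) = \<delta> A" if A: "finite A" "A \<subseteq> X" for A
    proof -
      have im: "(\<lambda>x\<in>X. inv_into X g x) ` A = inv_into X g ` A"
        using A by (intro image_cong refl) auto
      have sub: "inv_into X g ` A \<subseteq> X"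
        using A bij by (auto simp: bij_betw_def intro!: inv_into_into)
      have "g ` inv_into X g ` A = A"
        using A bij by (intro image_inv_into_cancel) (auto simp: bij_betw_def)
      moreover have "\<delta> (g ` inv_into X g ` A) = \<delta> (inv_into X g ` A)"
        using g sub A by (auto simp: diversity_iso_def diversity_embedding_def)
      ultimately show ?thesis unfolding im by simp
    qed
    with iB show "inv\<^bsub>BijGroup X\<^esub> g \<in> ?H"
      unfolding inv by (rule memI)
  next
    fix g h assume gh: "g \<in> ?H" "h \<in> ?H"
    then have eq: "g \<otimes>\<^bsub>BijGroup X\<^esub> h = compose X g h" by (simp add: BijGroup_def)
    have cB: "compose X g h \<in> Bij X" using gh by (auto intro: compose_Bij)
    have "\<delta> (compose X g h ` A) = \<delta> A" if A: "finite A" "A \<subseteq> X" for A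
    proof -
      have "compose X g h ` A = g ` (h ` A)"
        using A by (auto simp: compose_def subset_iff)
      moreover have "h ` A \<subseteq> X" using gh A by (auto simp: diversity_iso_def)
      ultimately show ?thesis
        using gh A by (simp add: diversity_iso_def diversity_embedding_def)
    qed
    with cB show "g \<otimes>\<^bsub>BijGroup X\<^esub> h \<in> ?H"
      unfolding eq by (rule memI)
  qed
  then show ?thesis by (simp add: diversity_Aut_def)
qed

lemma group_diversity_Aut: "group (diversity_Aut X \<delta>)"
  using subgroup.subgroup_is_group[OF subgroup_diversity_Aut group_BijGroup]
  by (simp add: diversity_Aut_def)

text \<open>The structure is determined up to isomorphism by the properties below. Every finite
  diversity is isomorphic to one carried by a finite set of natural numbers, so quantifying over
  those covers the whole class; in particular the carrier is infinite.\<close>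

definition QD_limit :: "'a set \<Rightarrow> ('a set \<Rightarrow> real) \<Rightarrow> bool" where
  "QD_limit \<Omega> \<delta> \<longleftrightarrow>
     countable \<Omega> \<and> rational_diversity \<Omega> \<delta> \<and>
     (\<forall>(X :: nat set) d. finite X \<and> rational_diversity X d
        \<longrightarrow> (\<exists>f. diversity_embedding X d \<Omega> \<delta> f)) \<and>
     (\<forall>A B f. finite A \<and> A \<subseteq> \<Omega> \<and> finite B \<and> B \<subseteq> \<Omega> \<and> diversity_iso A \<delta> B \<delta> f
        \<longrightarrow> (\<exists>g \<in> carrier (diversity_Aut \<Omega> \<delta>). \<forall>a\<in>A. g a = f a))"


section \<open>Complex Hilbert spaces\<close>

text \<open>A complex Hilbert space, presented as a complete real inner product space (whose inner
  product is the real part of the Hermitian one) with a complex structure. The Hermitian form is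
  linear in the first argument; since it is conjugate symmetric, its diagonal is real, hence
  equal to the squared norm.\<close>

class complex_hilbert = real_inner + complete_space +
  fixes scaleC :: "complex \<Rightarrow> 'a \<Rightarrow> 'a" (infixr "*\<^sub>C" 75)
    and cinner :: "'a \<Rightarrow> 'a \<Rightarrow> complex"
  assumes scaleC_add_right: "a *\<^sub>C (x + y) = a *\<^sub>C x + a *\<^sub>C y"
    and scaleC_add_left: "(a + b) *\<^sub>C x = a *\<^sub>C x + b *\<^sub>C x"
    and scaleC_scaleC: "a *\<^sub>C (b *\<^sub>C x) = (a * b) *\<^sub>C x"
    and scaleC_of_real: "complex_of_real r *\<^sub>C x = r *\<^sub>R x"
    and cinner_commute: "cinner x y = cnj (cinner y x)"
    and cinner_add_left: "cinner (x + y) z = cinner x z + cinner y z"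
    and cinner_scaleC_left: "cinner (a *\<^sub>C x) y = a * cinner x y"
    and inner_eq_Re_cinner: "inner x y = Re (cinner x y)"

lemma cinner_self: "cinner x x = complex_of_real ((norm x)\<^sup>2)"
proof (rule complex_eqI)
  show "Re (cinner x x) = Re (complex_of_real ((norm x)\<^sup>2))"
    by (simp add: inner_eq_Re_cinner[symmetric] power2_norm_eq_inner)
  have "Im (cinner x x) = - Im (cinner x x)"
    using arg_cong[OF cinner_commute[of x x], of Im] by simp
  then show "Im (cinner x x) = Im (complex_of_real ((norm x)\<^sup>2))" by simp
qed

instantiation complex :: complex_hilbert
begin

definition "scaleC_complex (a :: complex) (x :: complex) = a * x"

definition "cinner_complex (x :: complex) (y :: complex) = x * cnj y"

instance
  by standard
    (simp_all add: scaleC_complex_def cinner_complex_def inner_complex_def algebra_simps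
      scaleR_conv_of_real)

end

definition orth_proj :: "'h::complex_hilbert set \<Rightarrow> 'h \<Rightarrow> 'h" where
  "orth_proj M x = (THE y. y \<in> M \<and> (\<forall>z\<in>M. cinner (x - y) z = 0))"

definition unitary :: "('h::complex_hilbert \<Rightarrow> 'h) \<Rightarrow> bool" where
  "unitary U \<longleftrightarrow>
     bij U \<and> (\<forall>x y. U (x + y) = U x + U y) \<and> (\<forall>a x. U (a *\<^sub>C x) = a *\<^sub>C U x) \<and>
     (\<forall>x y. cinner (U x) (U y) = cinner x y)"

definition unitary_group :: "('h::complex_hilbert \<Rightarrow> 'h) monoid" where
  "unitary_group = \<lparr>carrier = {U. unitary U}, mult = (\<circ>), one = id\<rparr>"


section \<open>Dissociation\<close>

text \<open>Here \<open>G\<close> is a permutation group on \<open>\<Omega>\<close>, i.e. a subgroup of \<^term>\<open>BijGroup \<Omega>\<close>. The topology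
  of pointwise convergence is that of the power of the discrete space \<open>\<Omega>\<close>, whose points are
  extensional functions, too.\<close>

definition pointwise_topology :: "'a set \<Rightarrow> ('a \<Rightarrow> 'a) monoid \<Rightarrow> ('a \<Rightarrow> 'a) topology" where
  "pointwise_topology \<Omega> G =
     subtopology (product_topology (\<lambda>_. discrete_topology \<Omega>) \<Omega>) (carrier G)"

definition unitary_rep ::
    "'a set \<Rightarrow> ('a \<Rightarrow> 'a) monoid \<Rightarrow> (('a \<Rightarrow> 'a) \<Rightarrow> 'h::complex_hilbert \<Rightarrow> 'h) \<Rightarrow> bool" where
  "unitary_rep \<Omega> G \<pi> \<longleftrightarrow>
     \<pi> \<in> hom G unitary_group \<and>
     (\<forall>\<xi>. continuous_map (pointwise_topology \<Omega> G) euclidean (\<lambda>g. \<pi> g \<xi>))"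

definition pointwise_stabilizer :: "('a \<Rightarrow> 'a) monoid \<Rightarrow> 'a set \<Rightarrow> ('a \<Rightarrow> 'a) set" where
  "pointwise_stabilizer G A = {g \<in> carrier G. \<forall>a\<in>A. g a = a}"

definition fixed_vectors ::
    "('a \<Rightarrow> 'a) monoid \<Rightarrow> (('a \<Rightarrow> 'a) \<Rightarrow> 'h \<Rightarrow> 'h) \<Rightarrow> 'a set \<Rightarrow> 'h set" where
  "fixed_vectors G \<pi> A = {\<xi>. \<forall>g \<in> pointwise_stabilizer G A. \<pi> g \<xi> = \<xi>}"

definition dissociated_rep ::
    "'a set \<Rightarrow> ('a \<Rightarrow> 'a) monoid \<Rightarrow> (('a \<Rightarrow> 'a) \<Rightarrow> 'h::complex_hilbert \<Rightarrow> 'h) \<Rightarrow> bool" where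
  "dissociated_rep \<Omega> G \<pi> \<longleftrightarrow>
     (\<forall>A B. finite A \<and> A \<subseteq> \<Omega> \<and> finite B \<and> B \<subseteq> \<Omega> \<longrightarrow>
        orth_proj (fixed_vectors G \<pi> A) \<circ> orth_proj (fixed_vectors G \<pi> B) =
        orth_proj (fixed_vectors G \<pi> (A \<inter> B)))"

text \<open>The Hilbert space type \<open>'h\<close> is a parameter: a formula cannot quantify over types. A theorem
  asserting this with \<open>'h\<close> a type variable covers all Hilbert spaces.\<close>

definition dissociated :: "'h::complex_hilbert itself \<Rightarrow> 'a set \<Rightarrow> ('a \<Rightarrow> 'a) monoid \<Rightarrow> bool" where
  "dissociated _ \<Omega> G \<longleftrightarrow>
     (\<forall>\<pi> :: ('a \<Rightarrow> 'a) \<Rightarrow> 'h \<Rightarrow> 'h. unitary_rep \<Omega> G \<pi> \<longrightarrow> dissociated_rep \<Omega> G \<pi>)"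

end

theory Submission
  imports Defs
begin

text \<open>Write \<open>\<H>\<^sub>E\<close> for the vectors fixed by the pointwise stabilizer \<open>G\<^sub>E\<close> of a finite set \<open>E\<close>, and \<open>p\<^sub>E\<close> for the
  projection onto \<open>\<H>\<^sub>E\<close>. It suffices to show that \<open>p\<^sub>B\<close> maps \<open>\<H>\<^sub>A\<close> into \<open>\<H>\<close> of \<open>A \<inter> B\<close>, and by induction on
  the points of \<open>B\<close> outside \<open>A\<close> this follows from the case in which one point is dropped: if \<open>\<xi> \<in> \<H>\<^sub>A\<close> and
  \<open>b\<close> lies neither in \<open>A\<close> nor in \<open>E\<close>, then the projection \<open>\<eta>\<close> of \<open>\<xi>\<close> for the set \<open>E \<union> {b}\<close> lies in \<open>\<H>\<^sub>E\<close>
  (\<open>proj_in_Fix_remove_point\<close>).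

  The vector \<open>\<eta>\<close> is the element of minimal norm in the closed convex hull of the orbit of \<open>\<xi>\<close> under the
  stabilizer of \<open>E \<union> {b}\<close> (\<open>exists_projection_in_orbit_hull\<close>). So it is approximated by finite convex
  combinations of vectors \<open>\<pi> k \<xi>\<close>, and each of these is fixed by the stabilizer of \<open>k A\<close>. Hence \<open>\<eta>\<close> is
  almost fixed by \<open>G\<^sub>X\<close> for some finite sets \<open>X \<supseteq> E\<close>. As \<open>k\<close> fixes \<open>b\<close>, all these \<open>X\<close> keep a positive
  distance \<open>c\<close> from \<open>b\<close> that does not depend on the quality of the approximation.

  The set \<open>X\<close> is out of control otherwise, so one needs moves of \<open>b\<close> that can be realized inside \<open>G\<^sub>X\<close>
  for all such \<open>X\<close> while their effect on \<open>\<eta>\<close> is independent of \<open>X\<close>. Moves to a twin have both properties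
  (\<open>twin_moves_fix\<close>): a twin of \<open>b\<close> at any positive rational distance \<open>\<epsilon> \<le> c\<close> exists over every \<open>X\<close>
  (\<open>twin_realization\<close>), and the type over \<open>E\<close> of \<open>b\<close> and its twin depends on \<open>\<epsilon>\<close> only. So \<open>\<eta>\<close> is fixed by
  the elements of \<open>G\<^sub>E\<close> that move \<open>b\<close> to a twin over \<open>E\<close> at such a distance.

  Together with the stabilizer of \<open>E \<union> {b}\<close> these elements generate \<open>G\<^sub>E\<close>, because any two points of the
  same type over \<open>E\<close> are joined by a chain of twins over \<open>E\<close> (\<open>chain_of_twins\<close>). Such a chain is found by
  writing down a finite rational diversity on \<open>E\<close> and the points of the chain and realizing it in
  the limit.\<close>

section \<open>Orthogonal projections onto fixed vectors\<close>

lemma cinner_diff_left: "cinner (x - y) z = cinner x z - cinner y z" for x :: "'h::complex_hilbert"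
  using cinner_add_left[of "x - y" y z] by simp

lemma cinner_scaleC_right: "cinner x (a *\<^sub>C y) = cnj a * cinner x y" for x :: "'h::complex_hilbert"
  using cinner_commute[of x "a *\<^sub>C y"] cinner_commute[of x y] by (simp add: cinner_scaleC_left)

lemma cinner_self_eq_0_iff: "cinner x x = 0 \<longleftrightarrow> x = 0" for x :: "'h::complex_hilbert"
  by (simp add: cinner_self)

lemma orth_proj_eqI:
  assumes diff: "\<And>x y. x \<in> M \<Longrightarrow> y \<in> M \<Longrightarrow> x - y \<in> M"
    and y: "y \<in> M" "\<And>z. z \<in> M \<Longrightarrow> cinner (x - y) z = 0"
  shows "orth_proj M x = y"
  unfolding orth_proj_def
proof (rule the_equality)
  show "y \<in> M \<and> (\<forall>z\<in>M. cinner (x - y) z = 0)" using y by simp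
next
  fix y' assume y': "y' \<in> M \<and> (\<forall>z\<in>M. cinner (x - y') z = 0)"
  have mem: "y - y' \<in> M" using diff y y' by blast
  have "cinner (x - y') (y - y') - cinner (x - y) (y - y') = 0"
    using mem y(2) y' by simp
  then have "cinner (y - y') (y - y') = 0" by (simp add: cinner_diff_left)
  then show "y' = y" by (simp add: cinner_self_eq_0_iff)
qed

lemma linear_unitary:
  assumes "unitary U"
  shows "linear U"
proof (rule linearI)
  show "U (x + y) = U x + U y" for x y using assms by (simp add: unitary_def)
  show "U (r *\<^sub>R x) = r *\<^sub>R U x" for r x
    using assms unfolding unitary_def by (simp flip: scaleC_of_real)
qed

lemma norm_unitary:
  assumes "unitary U"
  shows "norm (U x) = norm x"
  using assms by (simp add: unitary_def norm_eq_sqrt_inner inner_eq_Re_cinner)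

lemma bounded_linear_unitary:
  assumes "unitary U"
  shows "bounded_linear U"
  by (rule bounded_linear_intro[where K = 1])
    (simp_all add: norm_unitary[OF assms] linear_add[OF linear_unitary[OF assms]]
      linear_scale[OF linear_unitary[OF assms]])

text \<open>The parallelogram law, with the norm of the midpoint bounded from below. In a convex set whose
  elements all have squared norm at least \<open>d\<close>, it forces two elements of almost minimal norm to be
  close to each other; this gives both existence and uniqueness of an element of minimal norm.\<close>

lemma norm_diff_sq_le_of_midpoint:
  fixes x y :: "'h::real_inner"
  assumes "d \<le> (norm ((1/2) *\<^sub>R x + (1/2) *\<^sub>R y))\<^sup>2"
  shows "(norm (x - y))\<^sup>2 \<le> 2 * (norm x)\<^sup>2 + 2 * (norm y)\<^sup>2 - 4 * d"
  using assms
  by (simp add: power2_norm_eq_inner inner_add_left inner_add_right inner_diff_left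
      inner_diff_right inner_commute algebra_simps)

lemma min_norm_unique:
  fixes x y :: "'h::real_inner"
  assumes "convex K" "x \<in> K" "y \<in> K" "norm y = norm x"
    and min: "\<And>z. z \<in> K \<Longrightarrow> norm x \<le> norm z"
  shows "y = x"
proof -
  have "(1/2) *\<^sub>R x + (1/2) *\<^sub>R y \<in> K"
    using assms(1-3) by (intro convexD) auto
  then have "(norm x)\<^sup>2 \<le> (norm ((1/2) *\<^sub>R x + (1/2) *\<^sub>R y))\<^sup>2"
    by (intro power_mono min) auto
  from norm_diff_sq_le_of_midpoint[OF this] have "(norm (x - y))\<^sup>2 \<le> 0"
    using assms(4) by simp
  then show ?thesis by simp
qed

lemma min_norm_exists:
  fixes K :: "'h::{real_inner,complete_space} set"
  assumes K: "closed K" "convex K" "K \<noteq> {}"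
  obtains x where "x \<in> K" "\<And>z. z \<in> K \<Longrightarrow> norm x \<le> norm z"
proof -
  define d where "d = (INF z\<in>K. (norm z)\<^sup>2)"
  have bdd: "bdd_below ((\<lambda>z. (norm z)\<^sup>2) ` K)" by (rule bdd_belowI[of _ 0]) auto
  have d_le: "d \<le> (norm z)\<^sup>2" if "z \<in> K" for z
    unfolding d_def using bdd that by (rule cINF_lower)
  have "\<exists>z\<in>K. (norm z)\<^sup>2 < d + 1 / Suc n" for n
  proof -
    have "(INF z\<in>K. (norm z)\<^sup>2) < d + 1 / Suc n" by (simp add: d_def)
    then show ?thesis using cINF_less_iff[OF K(3) bdd] by blast
  qed
  then obtain z where z: "z n \<in> K" "(norm (z n))\<^sup>2 < d + 1 / Suc n" for n by metis
  have close: "(norm (z m - z n))\<^sup>2 \<le> 2 / Suc m + 2 / Suc n" for m n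
  proof -
    have "(1/2) *\<^sub>R z m + (1/2) *\<^sub>R z n \<in> K"
      using K z(1) by (intro convexD) auto
    from norm_diff_sq_le_of_midpoint[OF d_le[OF this]] show ?thesis
      using z(2)[of m] z(2)[of n] by simp
  qed
  have "Cauchy z"
  proof (rule CauchyI)
    fix e :: real assume e: "0 < e"
    obtain N where N: "4 / e\<^sup>2 < real N" using reals_Archimedean2 by blast
    have small: "2 / Suc m \<le> e\<^sup>2 / 2" if "m \<ge> N" for m
    proof -
      have "4 / e\<^sup>2 \<le> real (Suc m)" using N that by linarith
      then show ?thesis using e by (simp add: field_simps)
    qed
    have "norm (z m - z n) < e" if mn: "m \<ge> Suc N" "n \<ge> Suc N" for m n
    proof -
      have "2 / Suc m < 2 / Suc N" using mn by (simp add: frac_less2)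
      then have "(norm (z m - z n))\<^sup>2 < e\<^sup>2"
        using close[of m n] small[of N] small[of n] mn by simp
      then show ?thesis using e by (simp add: power2_less_imp_less)
    qed
    then show "\<exists>M. \<forall>m\<ge>M. \<forall>n\<ge>M. norm (z m - z n) < e" by blast
  qed
  then obtain x where x: "z \<longlonglongrightarrow> x" using Cauchy_convergent convergent_def by blast
  have "x \<in> K" using closed_sequentially[OF K(1)] z(1) x by blast
  moreover have "norm x \<le> norm y" if "y \<in> K" for y
  proof -
    have "(\<lambda>n. (norm (z n))\<^sup>2) \<longlonglongrightarrow> (norm x)\<^sup>2" by (intro tendsto_intros x)
    moreover have "(\<lambda>n. d + 1 / Suc n) \<longlonglongrightarrow> d + 0"
      using LIMSEQ_inverse_real_of_nat by (intro tendsto_add) (simp_all add: inverse_eq_divide)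
    ultimately have "(norm x)\<^sup>2 \<le> d + 0"
      by (rule LIMSEQ_le) (use z(2) less_imp_le in blast)
    then show ?thesis using d_le[OF that] by (simp add: power2_le_imp_le)
  qed
  ultimately show ?thesis using that by blast
qed

lemma hom_unitary_groupD:
  assumes "\<pi> \<in> hom G unitary_group"
  shows "g \<in> carrier G \<Longrightarrow> unitary (\<pi> g)"
    and "g \<in> carrier G \<Longrightarrow> h \<in> carrier G \<Longrightarrow> \<pi> (g \<otimes>\<^bsub>G\<^esub> h) \<xi> = \<pi> g (\<pi> h \<xi>)"
  using assms by (auto simp: hom_def unitary_group_def Pi_def)

text \<open>The Alaoglu--Birkhoff argument: the closed convex hull of the orbit of \<open>\<xi>\<close> is invariant under the
  group, hence so is its unique element of minimal norm. Pairing with a fixed vector is constant on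
  the orbit, hence on its closed convex hull, so this element differs from \<open>\<xi>\<close> by a vector orthogonal
  to all fixed vectors. Thus the projection of \<open>\<xi>\<close> onto the fixed vectors exists and, which is the
  point, is a limit of finite convex combinations of translates of \<open>\<xi>\<close>.\<close>

lemma exists_projection_in_orbit_hull:
  fixes \<pi> :: "'g \<Rightarrow> 'h::complex_hilbert \<Rightarrow> 'h"
  assumes "group G" and \<pi>: "\<pi> \<in> hom G unitary_group" and H: "subgroup H G"
  obtains \<eta> where "\<forall>g\<in>H. \<pi> g \<eta> = \<eta>"
    and "\<eta> \<in> closure (convex hull ((\<lambda>g. \<pi> g \<xi>) ` H))"
    and "\<And>\<zeta>. \<forall>g\<in>H. \<pi> g \<zeta> = \<zeta> \<Longrightarrow> cinner (\<xi> - \<eta>) \<zeta> = 0"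
proof -
  interpret group G by fact
  interpret H: subgroup H G by fact
  note U = hom_unitary_groupD(1)[OF \<pi>] and mult = hom_unitary_groupD(2)[OF \<pi>]
  have ne: "H \<noteq> {}" using H.one_closed by blast
  define K where "K = closure (convex hull ((\<lambda>g. \<pi> g \<xi>) ` H))"
  have conv: "convex K" and "closed K" "K \<noteq> {}"
    using ne by (simp_all add: K_def)
  then obtain \<eta> where \<eta>: "\<eta> \<in> K" and min: "\<And>z. z \<in> K \<Longrightarrow> norm \<eta> \<le> norm z"
    using min_norm_exists by blast
  have "\<pi> g \<eta> \<in> K" if g: "g \<in> H" for g
  proof -
    have Ug: "unitary (\<pi> g)" by (rule U[OF H.mem_carrier[OF g]])
    have "\<pi> g ` K \<subseteq> closure (\<pi> g ` (convex hull ((\<lambda>g. \<pi> g \<xi>) ` H)))"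
      unfolding K_def by (rule closure_bounded_linear_image_subset[OF bounded_linear_unitary[OF Ug]])
    also have "\<dots> = closure (convex hull (\<pi> g ` ((\<lambda>g. \<pi> g \<xi>) ` H)))"
      by (simp add: convex_hull_linear_image[OF linear_unitary[OF Ug]])
    also have "\<dots> \<subseteq> K"
      unfolding K_def
    proof (intro closure_mono hull_mono)
      show "\<pi> g ` (\<lambda>g. \<pi> g \<xi>) ` H \<subseteq> (\<lambda>g. \<pi> g \<xi>) ` H"
        using g mult[symmetric] H.m_closed H.mem_carrier by fastforce
    qed
    finally show ?thesis using \<eta> by blast
  qed
  then have fixed: "\<forall>g\<in>H. \<pi> g \<eta> = \<eta>"
    by (intro ballI min_norm_unique[OF conv \<eta> _ _ min] norm_unitary[OF U] H.mem_carrier)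
  have real_orth: "inner (\<xi> - \<eta>) \<zeta> = 0" if \<zeta>: "\<forall>g\<in>H. \<pi> g \<zeta> = \<zeta>" for \<zeta>
  proof -
    have "inner \<zeta> (\<pi> g \<xi>) = inner \<zeta> \<xi>" if g: "g \<in> H" for g
    proof -
      have "cinner (\<pi> g \<zeta>) (\<pi> g \<xi>) = cinner \<zeta> \<xi>"
        using U[OF H.mem_carrier[OF g]] unfolding unitary_def by blast
      then show ?thesis using \<zeta> g by (simp add: inner_eq_Re_cinner)
    qed
    then have "K \<subseteq> {x. inner \<zeta> x = inner \<zeta> \<xi>}"
      unfolding K_def
      by (intro closure_minimal hull_minimal closed_hyperplane convex_hyperplane) auto
    then have "inner \<zeta> \<eta> = inner \<zeta> \<xi>" using \<eta> by blast
    then show ?thesis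
      by (simp add: inner_diff_left inner_commute[of \<xi> \<zeta>] inner_commute[of \<eta> \<zeta>])
  qed
  have "cinner (\<xi> - \<eta>) \<zeta> = 0" if \<zeta>: "\<forall>g\<in>H. \<pi> g \<zeta> = \<zeta>" for \<zeta>
  proof (rule complex_eqI)
    show "Re (cinner (\<xi> - \<eta>) \<zeta>) = Re 0"
      using real_orth[OF \<zeta>] by (simp add: inner_eq_Re_cinner)
    \<comment> \<open>Real orthogonality to \<open>\<i> \<zeta>\<close>, which is fixed as well, is the vanishing of the imaginary part.\<close>
    have "\<forall>g\<in>H. \<pi> g (\<i> *\<^sub>C \<zeta>) = \<i> *\<^sub>C \<zeta>"
      using \<zeta> U H.mem_carrier unfolding unitary_def by metis
    from real_orth[OF this] show "Im (cinner (\<xi> - \<eta>) \<zeta>) = Im 0"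
      by (simp add: inner_eq_Re_cinner cinner_scaleC_right)
  qed
  then show ?thesis using that[of \<eta>] fixed \<eta> K_def by blast
qed

section \<open>Diversities from weights on a line\<close>

lemma diversity_eq_0_iff:
  assumes "diversity X \<delta>" "finite T" "T \<subseteq> X"
  shows "\<delta> T = 0 \<longleftrightarrow> card T \<le> 1"
  using assms(1) unfolding diversity_def
  by (elim conjE) (use assms(2-) in blast)

lemma diversity_triangle:
  assumes "diversity X \<delta>" "finite A" "A \<subseteq> X" "finite B" "B \<subseteq> X" "finite C" "C \<subseteq> X" "B \<noteq> {}"
  shows "\<delta> (A \<union> C) \<le> \<delta> (A \<union> B) + \<delta> (B \<union> C)"
  using assms(1) unfolding diversity_def
  by (elim conjE) (use assms(2-) in blast)

lemma diversity_mono: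
  assumes X: "diversity X \<delta>" and "finite T" "T \<subseteq> X" "S \<subseteq> T"
  shows "\<delta> S \<le> \<delta> T"
proof -
  have step: "\<delta> A \<le> \<delta> (insert x A)" if "finite A" "A \<subseteq> X" "x \<in> X" for A x
  proof -
    have "\<delta> (A \<union> {}) \<le> \<delta> (A \<union> {x}) + \<delta> ({x} \<union> {})"
      using that by (intro diversity_triangle[OF X]) auto
    moreover have "\<delta> {x} = 0" using diversity_eq_0_iff[OF X, of "{x}"] that by simp
    ultimately show ?thesis by simp
  qed
  have "\<delta> S \<le> \<delta> (S \<union> F)" if "finite F" "F \<subseteq> X" for F
    using that
  proof (induction F rule: finite_induct)
    case (insert x F)
    have "\<delta> (S \<union> F) \<le> \<delta> (insert x (S \<union> F))"
      using insert assms finite_subset by (intro step) auto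
    then show ?case using insert by simp
  qed simp
  from this[of T] show ?thesis using assms by (simp add: Un_absorb1)
qed

lemma diversity_Un_le:
  assumes X: "diversity X \<delta>" and "finite S" "S \<subseteq> X" "finite T" "T \<subseteq> X" "S \<inter> T \<noteq> {}"
  shows "\<delta> (S \<union> T) \<le> \<delta> S + \<delta> T"
proof -
  have "\<delta> (S \<union> T) \<le> \<delta> (S \<union> S \<inter> T) + \<delta> (S \<inter> T \<union> T)"
    using assms(2-) by (intro diversity_triangle[OF X]) auto
  then show ?thesis by (simp add: Un_absorb1 Un_absorb2)
qed

text \<open>Monotonicity together with subadditivity on overlapping sets is an equivalent form of the triangle
  inequality, and the one that is easy to check for the constructions below.\<close>

lemma diversityI:
  assumes zero: "\<And>A. finite A \<Longrightarrow> A \<subseteq> X \<Longrightarrow> \<delta> A = 0 \<longleftrightarrow> card A \<le> 1"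
    and mono: "\<And>A B. finite B \<Longrightarrow> B \<subseteq> X \<Longrightarrow> A \<subseteq> B \<Longrightarrow> \<delta> A \<le> \<delta> B"
    and Un: "\<And>A B. finite A \<Longrightarrow> A \<subseteq> X \<Longrightarrow> finite B \<Longrightarrow> B \<subseteq> X \<Longrightarrow> A \<inter> B \<noteq> {} \<Longrightarrow>
      \<delta> (A \<union> B) \<le> \<delta> A + \<delta> B"
  shows "diversity X \<delta>"
  unfolding diversity_def
proof (intro conjI allI impI)
  fix A assume A: "finite A \<and> A \<subseteq> X"
  then show "\<delta> A = 0 \<longleftrightarrow> card A \<le> 1" using zero by blast
  show "0 \<le> \<delta> A" using mono[of A "{}"] zero[of "{}"] A by simp
next
  fix A B C
  assume *: "finite A \<and> A \<subseteq> X \<and> finite B \<and> B \<subseteq> X \<and> finite C \<and> C \<subseteq> X \<and> B \<noteq> {}"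
  have "\<delta> (A \<union> C) \<le> \<delta> ((A \<union> B) \<union> (B \<union> C))" using * by (intro mono) auto
  also have "\<dots> \<le> \<delta> (A \<union> B) + \<delta> (B \<union> C)" using * by (intro Un) auto
  finally show "\<delta> (A \<union> C) \<le> \<delta> (A \<union> B) + \<delta> (B \<union> C)" .
qed

text \<open>The points \<open>Inr i\<close> are to be copies of a single point \<open>b\<close>, placed one after the other on a line over
  the set \<open>E\<close> of points \<open>Inl e\<close>. A set with some copies in it is measured by its part in \<open>E\<close> and by the
  distance between its first and its last copy only.\<close>

definition line_diversity ::
    "('a set \<Rightarrow> real) \<Rightarrow> ('a set \<Rightarrow> nat \<Rightarrow> real) \<Rightarrow> ('a + nat) set \<Rightarrow> real" where
  "line_diversity \<delta> w S =
     (let T = Inl -` S; I = Inr -` S in if I = {} then \<delta> T else w T (Max I - Min I))"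

lemma line_diversity_Plus:
  "line_diversity \<delta> w (Inl ` T \<union> Inr ` I) = (if I = {} then \<delta> T else w T (Max I - Min I))"
proof -
  have "Inl -` (Inl ` T \<union> Inr ` I) = T" "Inr -` (Inl ` T \<union> Inr ` I) = I" by auto
  then show ?thesis by (simp add: line_diversity_def)
qed

lemma span_mono:
  fixes I J :: "nat set"
  assumes "finite J" "I \<subseteq> J" "I \<noteq> {}"
  shows "Max I - Min I \<le> Max J - Min J"
  using Max_mono[OF assms(2,3,1)] Min_antimono[OF assms(2,3,1)] by (rule diff_le_mono[THEN le_trans, OF _ diff_le_mono2])

lemma span_Un_le:
  fixes I J :: "nat set"
  assumes fin: "finite I" "finite J" and "I \<inter> J \<noteq> {}"
  shows "Max (I \<union> J) - Min (I \<union> J) \<le> (Max I - Min I) + (Max J - Min J)"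
proof -
  obtain i where i: "i \<in> I" "i \<in> J" using assms(3) by blast
  then have "Min I \<le> i" "i \<le> Max I" "Min J \<le> i" "i \<le> Max J" using fin by auto
  moreover have "Max (I \<union> J) = max (Max I) (Max J)" "Min (I \<union> J) = min (Min I) (Min J)"
    using fin i by (auto intro: Max_Un Min_Un)
  ultimately show ?thesis by linarith
qed

lemma sum_set_cases:
  obtains T I where "S = Inl ` T \<union> Inr ` I"
proof
  show "S = Inl ` (Inl -` S) \<union> Inr ` (Inr -` S)"
  proof -
    have "x \<in> S \<longleftrightarrow> x \<in> Inl ` (Inl -` S) \<union> Inr ` (Inr -` S)" for x
      by (cases x) auto
    then show ?thesis by blast
  qed
qed

text \<open>What \<open>w T k\<close> must satisfy in order to be the diversity of \<open>T\<close> together with copies of \<open>b\<close> that are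
  \<open>k\<close> steps apart. Two sets that both contain copies overlap either in a copy, and then their spans
  add up (\<open>add\<close>), or only in \<open>E\<close>, and then the span of their union is not controlled by their spans
  (\<open>overlap\<close>); \<open>base\<close> is for an overlap of a set with copies and a set without.\<close>

locale line_weight =
  fixes X :: "'a set" and \<delta> :: "'a set \<Rightarrow> real" and E :: "'a set" and b :: 'a
    and w :: "'a set \<Rightarrow> nat \<Rightarrow> real"
  assumes \<delta>: "rational_diversity X \<delta>"
    and E: "finite E" "E \<subseteq> X" and b: "b \<in> X" "b \<notin> E"
    and mono: "S \<subseteq> T \<Longrightarrow> T \<subseteq> E \<Longrightarrow> k \<le> l \<Longrightarrow> w S k \<le> w T l"
    and zero: "T \<subseteq> E \<Longrightarrow> w T 0 = \<delta> (insert b T)"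
    and pos: "0 < w {} 1"
    and rat: "T \<subseteq> E \<Longrightarrow> w T k \<in> \<rat>"
    and add: "S \<subseteq> E \<Longrightarrow> T \<subseteq> E \<Longrightarrow> w (S \<union> T) (k + l) \<le> w S k + w T l"
    and overlap: "S \<subseteq> E \<Longrightarrow> T \<subseteq> E \<Longrightarrow> S \<inter> T \<noteq> {} \<Longrightarrow>
      w (S \<union> T) k \<le> \<delta> (insert b S) + \<delta> (insert b T)"
    and base: "S \<subseteq> E \<Longrightarrow> T \<subseteq> E \<Longrightarrow> S \<inter> T \<noteq> {} \<Longrightarrow> w (S \<union> T) k \<le> w S k + \<delta> T"

lemma (in line_weight) rational_line_diversity:
  "rational_diversity (Inl ` E \<union> Inr ` {..n}) (line_diversity \<delta> w)"
proof -
  let ?Z = "Inl ` E \<union> Inr ` {..n}" and ?d = "line_diversity \<delta> w"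
  have div: "diversity X \<delta>" using \<delta> by (simp add: rational_diversity_def)
  have fin: "finite T" if "T \<subseteq> E" for T using that E(1) by (rule finite_subset)
  have w_nonneg: "w T 0 \<le> w T k" if "T \<subseteq> E" for T k using mono[of T T 0 k] that by simp
  have *: "\<exists>T I. S = Inl ` T \<union> Inr ` I \<and> T \<subseteq> E \<and> I \<subseteq> {..n} \<and> finite T \<and> finite I"
    if "S \<subseteq> ?Z" for S
  proof -
    obtain T I where "S = Inl ` T \<union> Inr ` I" by (rule sum_set_cases)
    then have "T \<subseteq> E" "I \<subseteq> {..n}" using that by auto
    then have "finite T" "finite I" using fin finite_subset[OF _ finite_atMost] by simp_all
    then show ?thesis using \<open>T \<subseteq> E\<close> \<open>I \<subseteq> {..n}\<close> \<open>S = _\<close> by blast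
  qed
  have "diversity ?Z ?d"
  proof (rule diversityI)
    fix S assume "S \<subseteq> ?Z"
    from *[OF this] obtain T I where S: "S = Inl ` T \<union> Inr ` I" and TI: "T \<subseteq> E" "I \<subseteq> {..n}" "finite T" "finite I"
      by blast
    have card: "card S = card T + card I"
      unfolding S using TI(3,4) by (subst card_Un_disjoint) (auto simp: card_image)
    have dS: "?d S = (if I = {} then \<delta> T else w T (Max I - Min I))"
      unfolding S by (rule line_diversity_Plus)
    consider "I = {}" | "I \<noteq> {}" "Max I = Min I" | "I \<noteq> {}" "Max I \<noteq> Min I" by blast
    then show "?d S = 0 \<longleftrightarrow> card S \<le> 1"
    proof cases
      case 1
      have "\<delta> T = 0 \<longleftrightarrow> card T \<le> 1"
        using TI E by (intro diversity_eq_0_iff[OF div]) auto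
      then show ?thesis using 1 card dS by simp
    next
      case 2
      have "I \<subseteq> {Max I}"
      proof
        fix i assume "i \<in> I"
        from Max_ge[OF TI(4) this] Min_le[OF TI(4) this] show "i \<in> {Max I}"
          using 2(2) by simp
      qed
      from card_mono[OF _ this] have "card I \<le> 1" by simp
      moreover have "card I \<noteq> 0" using 2(1) TI(4) by simp
      ultimately have card_S: "card S = Suc (card T)" using card by linarith
      have "b \<notin> T" using TI(1) b by blast
      then have card_bT: "card (insert b T) = Suc (card T)" using TI(3) by simp
      have "\<delta> (insert b T) = 0 \<longleftrightarrow> card (insert b T) \<le> 1"
        using TI(1,3) E b by (intro diversity_eq_0_iff[OF div]) auto
      moreover have "?d S = \<delta> (insert b T)"
        using dS 2 zero[OF TI(1)] by simp
      ultimately show ?thesis unfolding card_S card_bT by simp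
    next
      case 3
      have "Min I \<le> Max I" using 3(1) TI(4) by simp
      then have pos_len: "1 \<le> Max I - Min I" using 3(2) by linarith
      have "card {Max I, Min I} \<le> card I" using 3(1) TI(4) by (intro card_mono) auto
      moreover have "card {Max I, Min I} = 2" using 3(2) by simp
      moreover have "w {} 1 \<le> w T (Max I - Min I)" by (rule mono[OF _ TI(1) pos_len]) simp
      ultimately have "?d S > 0" "card S \<ge> 2" using 3(1) pos card dS by simp_all
      then show ?thesis by linarith
    qed
  next
    fix R S assume RS_S: "S \<subseteq> ?Z" and RS: "R \<subseteq> S"
    obtain T I where S: "S = Inl ` T \<union> Inr ` I" and TI: "T \<subseteq> E" "I \<subseteq> {..n}" "finite T" "finite I"
      using *[OF RS_S] by blast
    obtain U J where R: "R = Inl ` U \<union> Inr ` J" by (rule sum_set_cases)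
    have dS: "?d S = (if I = {} then \<delta> T else w T (Max I - Min I))"
      unfolding S by (rule line_diversity_Plus)
    have dR: "?d R = (if J = {} then \<delta> U else w U (Max J - Min J))"
      unfolding R by (rule line_diversity_Plus)
    have sub: "U \<subseteq> T" "J \<subseteq> I" using RS by (auto simp: R S)
    have TX: "insert b T \<subseteq> X" using TI E b by blast
    show "?d R \<le> ?d S"
    proof (cases "J = {}")
      case True
      have "\<delta> U \<le> \<delta> T" using sub TI TX by (intro diversity_mono[OF div]) auto
      moreover have "\<delta> U \<le> w T k" for k
      proof -
        have "\<delta> U \<le> \<delta> (insert b T)" using sub TI TX by (intro diversity_mono[OF div]) auto
        also have "\<dots> \<le> w T k" using w_nonneg[of T k] zero[of T] TI by simp
        finally show ?thesis .
      qed
      ultimately show ?thesis using True dR dS by simp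
    next
      case False
      then have "w U (Max J - Min J) \<le> w T (Max I - Min I)"
        using sub TI by (intro mono span_mono) auto
      then show ?thesis using False sub dR dS by auto
    qed
  next
    fix R S assume RS_R: "R \<subseteq> ?Z" and RS_S: "S \<subseteq> ?Z" and meet: "R \<inter> S \<noteq> {}"
    obtain T I where S: "S = Inl ` T \<union> Inr ` I" and TI: "T \<subseteq> E" "I \<subseteq> {..n}" "finite T" "finite I"
      using *[OF RS_S] by blast
    obtain U J where R: "R = Inl ` U \<union> Inr ` J" and UJ: "U \<subseteq> E" "J \<subseteq> {..n}" "finite U" "finite J"
      using *[OF RS_R] by blast
    have meet: "U \<inter> T \<noteq> {} \<or> J \<inter> I \<noteq> {}" using meet by (auto simp: R S)
    have dS: "?d S = (if I = {} then \<delta> T else w T (Max I - Min I))"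
      unfolding S by (rule line_diversity_Plus)
    have dR: "?d R = (if J = {} then \<delta> U else w U (Max J - Min J))"
      unfolding R by (rule line_diversity_Plus)
    have "R \<union> S = Inl ` (U \<union> T) \<union> Inr ` (J \<union> I)" by (auto simp: R S)
    then have dRS: "?d (R \<union> S) =
        (if J \<union> I = {} then \<delta> (U \<union> T) else w (U \<union> T) (Max (J \<union> I) - Min (J \<union> I)))"
      by (simp only: line_diversity_Plus)
    define k l where "k = Max J - Min J" and "l = Max I - Min I"
    consider "I = {}" "J = {}" | "I = {}" "J \<noteq> {}" | "I \<noteq> {}" "J = {}"
      | "I \<noteq> {}" "J \<noteq> {}" "J \<inter> I \<noteq> {}" | "I \<noteq> {}" "J \<noteq> {}" "U \<inter> T \<noteq> {}" using meet by blast
    then show "?d (R \<union> S) \<le> ?d R + ?d S"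
    proof cases
      case 1
      then have "\<delta> (U \<union> T) \<le> \<delta> U + \<delta> T"
        using meet TI UJ E by (intro diversity_Un_le[OF div]) auto
      then show ?thesis using 1 dR dS dRS by simp
    next
      case 2
      then show ?thesis using meet base[of U T k] TI(1) UJ(1) dR dS dRS k_def by simp
    next
      case 3
      then have "w (T \<union> U) l \<le> w T l + \<delta> U"
        using meet TI(1) UJ(1) by (intro base) auto
      then show ?thesis using 3 dR dS dRS l_def by (simp add: Un_commute)
    next
      case 4
      have "w (U \<union> T) (Max (J \<union> I) - Min (J \<union> I)) \<le> w (U \<union> T) (k + l)"
        unfolding k_def l_def using 4 TI UJ by (intro mono span_Un_le) auto
      also have "\<dots> \<le> w U k + w T l" using TI UJ by (intro add)
      finally show ?thesis using 4 dR dS dRS k_def l_def by simp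
    next
      case 5
      have "w (U \<union> T) (Max (J \<union> I) - Min (J \<union> I)) \<le> w U 0 + w T 0"
        using overlap[of U T] zero TI UJ 5 by simp
      also have "\<dots> \<le> w U k + w T l" using TI UJ w_nonneg by (intro add_mono) auto
      finally show ?thesis using 5 dR dS dRS k_def l_def by simp
    qed
  qed
  moreover have "?d S \<in> \<rat>" if S_sub: "S \<subseteq> ?Z" for S
  proof -
    obtain T I where S: "S = Inl ` T \<union> Inr ` I" and TI: "T \<subseteq> E" "I \<subseteq> {..n}" "finite T" "finite I"
      using *[OF S_sub] by blast
    have "T \<subseteq> X" using TI(1) E(2) by (rule subset_trans)
    then have "\<delta> T \<in> \<rat>" using \<delta> TI(3) unfolding rational_diversity_def by blast
    then show ?thesis using rat[OF TI(1)] unfolding S line_diversity_Plus by simp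
  qed
  ultimately show ?thesis by (simp add: rational_diversity_def)
qed

section \<open>The limit: extension of finite pieces and homogeneity\<close>

lemma rational_diversity_pullback:
  assumes Z: "rational_diversity Z d" and j: "inj_on j W" "j ` W \<subseteq> Z"
  shows "rational_diversity W (\<lambda>S. d (j ` S))"
proof -
  have div: "diversity Z d" using Z by (simp add: rational_diversity_def)
  have sub: "j ` A \<subseteq> Z" if "A \<subseteq> W" for A using j(2) image_mono[OF that] by (rule order_trans[rotated])
  have "diversity W (\<lambda>S. d (j ` S))"
  proof (rule diversityI)
    fix A assume "finite A" "A \<subseteq> W"
    then show "d (j ` A) = 0 \<longleftrightarrow> card A \<le> 1"
      using diversity_eq_0_iff[OF div _ sub] card_image[OF inj_on_subset[OF j(1)]] by simp
  next
    fix A B assume "finite B" "B \<subseteq> W" "A \<subseteq> B"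
    then show "d (j ` A) \<le> d (j ` B)" by (intro diversity_mono[OF div] sub image_mono) auto
  next
    fix A B assume "finite A" "A \<subseteq> W" "finite B" "B \<subseteq> W" "A \<inter> B \<noteq> {}"
    then show "d (j ` (A \<union> B)) \<le> d (j ` A) + d (j ` B)"
      unfolding image_Un by (intro diversity_Un_le[OF div] sub) auto
  qed
  moreover have "d (j ` A) \<in> \<rat>" if "finite A" "A \<subseteq> W" for A
    using Z sub[OF that(2)] that(1) unfolding rational_diversity_def by blast
  ultimately show ?thesis by (simp add: rational_diversity_def)
qed

locale QD =
  fixes \<Omega> :: "'a set" and \<delta> :: "'a set \<Rightarrow> real"
  assumes limit: "QD_limit \<Omega> \<delta>"
begin

lemma rational: "rational_diversity \<Omega> \<delta>"
  using limit unfolding QD_limit_def by blast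

lemma diversity: "diversity \<Omega> \<delta>"
  using rational by (simp add: rational_diversity_def)

abbreviation "Aut \<equiv> diversity_Aut \<Omega> \<delta>"
abbreviation "Stab \<equiv> pointwise_stabilizer Aut"

sublocale Aut: group Aut by (rule group_diversity_Aut)

lemma AutD:
  assumes "g \<in> carrier Aut"
  shows "x \<in> \<Omega> \<Longrightarrow> g x \<in> \<Omega>"
    "finite T \<Longrightarrow> T \<subseteq> \<Omega> \<Longrightarrow> \<delta> (g ` T) = \<delta> T"
  using assms
  by (auto simp: diversity_Aut_def diversity_iso_def diversity_embedding_def)

lemma mult_apply:
  "g \<in> carrier Aut \<Longrightarrow> h \<in> carrier Aut \<Longrightarrow> x \<in> \<Omega> \<Longrightarrow> (g \<otimes>\<^bsub>Aut\<^esub> h) x = g (h x)"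
  by (simp add: diversity_Aut_def BijGroup_def compose_def)

lemma one_apply: "x \<in> \<Omega> \<Longrightarrow> \<one>\<^bsub>Aut\<^esub> x = x"
  by (simp add: diversity_Aut_def BijGroup_def)

lemma inv_apply:
  assumes g: "g \<in> carrier Aut" and x: "x \<in> \<Omega>"
  shows "(inv\<^bsub>Aut\<^esub> g) (g x) = x"
proof -
  have "(inv\<^bsub>Aut\<^esub> g) (g x) = (inv\<^bsub>Aut\<^esub> g \<otimes>\<^bsub>Aut\<^esub> g) x"
    using mult_apply[OF Aut.inv_closed[OF g] g x] by simp
  then show ?thesis using g x by (simp add: one_apply)
qed

lemma subgroup_Stab:
  assumes "E \<subseteq> \<Omega>"
  shows "subgroup (Stab E) Aut"
proof (rule Aut.subgroupI)
  show "Stab E \<subseteq> carrier Aut" by (auto simp: pointwise_stabilizer_def)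
  have "\<one>\<^bsub>Aut\<^esub> \<in> Stab E" using assms by (auto simp: pointwise_stabilizer_def one_apply)
  then show "Stab E \<noteq> {}" by blast
next
  fix g assume "g \<in> Stab E"
  then have g: "g \<in> carrier Aut" "\<And>x. x \<in> E \<Longrightarrow> g x = x" by (auto simp: pointwise_stabilizer_def)
  have "(inv\<^bsub>Aut\<^esub> g) x = x" if "x \<in> E" for x
    using inv_apply[OF g(1), of x] g(2)[OF that] that assms by auto
  then show "inv\<^bsub>Aut\<^esub> g \<in> Stab E" using g(1) by (simp add: pointwise_stabilizer_def)
next
  fix g h assume "g \<in> Stab E" "h \<in> Stab E"
  then show "g \<otimes>\<^bsub>Aut\<^esub> h \<in> Stab E"
    using assms by (auto simp: pointwise_stabilizer_def mult_apply)
qed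

lemma StabD:
  assumes "g \<in> Stab E"
  shows "g \<in> carrier Aut" "x \<in> E \<Longrightarrow> g x = x"
  using assms by (auto simp: pointwise_stabilizer_def)

lemma Stab_mono: "E \<subseteq> F \<Longrightarrow> Stab F \<subseteq> Stab E"
  by (auto simp: pointwise_stabilizer_def)

lemma Stab_image:
  assumes "g \<in> Stab E" "T \<subseteq> E"
  shows "g ` T = T"
  using StabD(2)[OF assms(1)] assms(2) by (force simp: image_iff)

text \<open>Injectivity of \<open>f\<close> comes for free, because the diversity of a pair tells whether its points are
  distinct.\<close>

lemma homogeneity:
  assumes Y: "finite Y" "Y \<subseteq> \<Omega>" and f: "\<And>y. y \<in> Y \<Longrightarrow> f y \<in> \<Omega>"
    and pres: "\<And>S. S \<subseteq> Y \<Longrightarrow> \<delta> (f ` S) = \<delta> S"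
  obtains g where "g \<in> carrier Aut" "\<And>y. y \<in> Y \<Longrightarrow> g y = f y"
proof -
  have "x = y" if "x \<in> Y" "y \<in> Y" "f x = f y" for x y
  proof -
    have "\<delta> (f ` {x, y}) = 0"
      using diversity_eq_0_iff[OF diversity, of "{f y}"] f that by simp
    then have "\<delta> {x, y} = 0" using pres[of "{x, y}"] that by simp
    then have "card {x, y} \<le> 1"
      using diversity_eq_0_iff[OF diversity, of "{x, y}"] that Y by auto
    then show ?thesis by (simp add: card_insert_if split: if_splits)
  qed
  then have "inj_on f Y" by (rule inj_onI)
  then have "diversity_iso Y \<delta> (f ` Y) \<delta> f"
    using pres by (simp add: diversity_iso_def diversity_embedding_def)
  moreover have "finite (f ` Y)" "f ` Y \<subseteq> \<Omega>" using Y f by auto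
  ultimately have "\<exists>g\<in>carrier Aut. \<forall>y\<in>Y. g y = f y"
    using limit Y unfolding QD_limit_def by blast
  then show ?thesis using that by blast
qed

text \<open>Universality and homogeneity combine to the extension property: a finite rational diversity that
  contains a copy of a finite part \<open>Y\<close> of the limit can be placed into the limit over \<open>Y\<close>. To see this,
  embed it anywhere and move the copy of \<open>Y\<close> back by an automorphism.\<close>

lemma extension:
  fixes Z :: "'b set"
  assumes Z: "finite Z" "rational_diversity Z d"
    and Y: "finite Y" "Y \<subseteq> \<Omega>" and i: "\<And>y. y \<in> Y \<Longrightarrow> i y \<in> Z"
    and pres: "\<And>S. S \<subseteq> Y \<Longrightarrow> d (i ` S) = \<delta> S"
  obtains f where "\<forall>z\<in>Z. f z \<in> \<Omega>" "\<forall>S\<subseteq>Z. \<delta> (f ` S) = d S" "\<forall>y\<in>Y. f (i y) = y"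
proof -
  obtain e :: "'b \<Rightarrow> nat" where e: "inj_on e Z"
    using finite_imp_inj_to_nat_seg[OF Z(1)] by blast
  let ?j = "inv_into Z e"
  have "rational_diversity (e ` Z) (\<lambda>S. d (?j ` S))"
    by (rule rational_diversity_pullback[OF Z(2)])
      (auto simp: inj_on_inv_into inv_into_into)
  then have "\<exists>h. diversity_embedding (e ` Z) (\<lambda>S. d (?j ` S)) \<Omega> \<delta> h"
    using limit Z(1) unfolding QD_limit_def by blast
  then obtain h where h: "diversity_embedding (e ` Z) (\<lambda>S. d (?j ` S)) \<Omega> \<delta> h" ..
  define k where "k z = h (e z)" for z
  have k: "k z \<in> \<Omega>" if "z \<in> Z" for z
    using h that by (auto simp: k_def diversity_embedding_def)
  have kd: "\<delta> (k ` S) = d S" if S: "S \<subseteq> Z" for S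
  proof -
    have "finite (e ` S)" "e ` S \<subseteq> e ` Z" using S Z(1) finite_subset by auto
    then have "\<delta> (h ` e ` S) = d (?j ` e ` S)"
      using h unfolding diversity_embedding_def by blast
    moreover have "?j ` e ` S = S" using e S by (rule inv_into_image_cancel)
    moreover have "k ` S = h ` e ` S" by (auto simp: k_def)
    ultimately show ?thesis by simp
  qed
  have "\<delta> ((\<lambda>y. k (i y)) ` S) = \<delta> S" if "S \<subseteq> Y" for S
  proof -
    have "(\<lambda>y. k (i y)) ` S = k ` i ` S" by auto
    moreover have "i ` S \<subseteq> Z" using that i by auto
    ultimately show ?thesis using kd pres[OF that] by simp
  qed
  then obtain g where g: "g \<in> carrier Aut" "\<And>y. y \<in> Y \<Longrightarrow> g y = k (i y)"
    using homogeneity[OF Y, of "\<lambda>y. k (i y)"] k i by metis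
  have g': "inv\<^bsub>Aut\<^esub> g \<in> carrier Aut" using g(1) by simp
  show ?thesis
  proof (rule that[of "\<lambda>z. (inv\<^bsub>Aut\<^esub> g) (k z)"]; intro ballI allI impI)
    show "(inv\<^bsub>Aut\<^esub> g) (k z) \<in> \<Omega>" if "z \<in> Z" for z
      using AutD(1)[OF g'] k that by blast
    show "\<delta> ((\<lambda>z. (inv\<^bsub>Aut\<^esub> g) (k z)) ` S) = d S" if "S \<subseteq> Z" for S
    proof -
      have "finite (k ` S)" "k ` S \<subseteq> \<Omega>" using finite_subset[OF that Z(1)] k that by auto
      then have "\<delta> ((inv\<^bsub>Aut\<^esub> g) ` k ` S) = \<delta> (k ` S)" by (rule AutD(2)[OF g'])
      then show ?thesis using kd[OF that] by (simp add: image_image)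
    qed
    show "(inv\<^bsub>Aut\<^esub> g) (k (i y)) = y" if "y \<in> Y" for y
      using inv_apply[OF g(1), of y] g(2)[OF that] Y(2) that by auto
  qed
qed

lemma move_point:
  assumes E: "finite E" "E \<subseteq> \<Omega>" and b: "b \<in> \<Omega>" "b' \<in> \<Omega>"
    and same: "\<And>T. T \<subseteq> E \<Longrightarrow> \<delta> (insert b' T) = \<delta> (insert b T)"
  obtains g where "g \<in> Stab E" "g b = b'"
proof -
  have b_in: "b' = b" if "b \<in> E"
  proof -
    have "\<delta> {b', b} = 0"
      using same[of "{b}"] diversity_eq_0_iff[OF diversity, of "{b}"] that b by simp
    then have "card {b', b} \<le> 1" using diversity_eq_0_iff[OF diversity, of "{b', b}"] b by simp
    then show ?thesis by (simp add: card_insert_if split: if_splits)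
  qed
  let ?f = "\<lambda>x. if x = b then b' else x"
  have "\<delta> (?f ` S) = \<delta> S" if S: "S \<subseteq> insert b E" for S
  proof (cases "b \<in> S")
    case True
    then have "?f ` S = insert b' (S - {b})" "insert b (S - {b}) = S" by auto
    moreover have "S - {b} \<subseteq> E" using S by blast
    ultimately show ?thesis using same[of "S - {b}"] by metis
  next
    case False
    then have "?f ` S = S" by auto
    then show ?thesis by simp
  qed
  then obtain g where g: "g \<in> carrier Aut" "\<And>y. y \<in> insert b E \<Longrightarrow> g y = ?f y"
    using homogeneity[of "insert b E" ?f] E b by (smt (verit) finite.insertI insert_iff subset_iff)
  have "g \<in> Stab E" using g b_in by (auto simp: pointwise_stabilizer_def)
  moreover have "g b = b'" using g(2) by simp
  ultimately show ?thesis using that by blast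
qed

lemma line_realization:
  assumes "line_weight \<Omega> \<delta> E b w"
  obtains p where "p 0 = b" "\<forall>i\<le>n. p i \<in> \<Omega>"
    "\<forall>T\<subseteq>E. \<forall>I\<subseteq>{..n}. I \<noteq> {} \<longrightarrow> \<delta> (T \<union> p ` I) = w T (Max I - Min I)"
proof -
  interpret W: line_weight \<Omega> \<delta> E b w by fact
  let ?Z = "Inl ` E \<union> Inr ` {..n}" and ?i = "\<lambda>y. if y = b then Inr (0::nat) else Inl y"
  have pres: "line_diversity \<delta> w (?i ` S) = \<delta> S" if S: "S \<subseteq> insert b E" for S
  proof (cases "b \<in> S")
    case True
    then have "?i ` S = Inl ` (S - {b}) \<union> Inr ` {0}" by auto
    moreover have "line_diversity \<delta> w (Inl ` (S - {b}) \<union> Inr ` {0}) = \<delta> (insert b (S - {b}))"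
      unfolding line_diversity_Plus using W.zero[of "S - {b}"] S by (simp add: subset_insert_iff True)
    ultimately show ?thesis by (simp only: insert_Diff[OF True])
  next
    case False
    then have "?i ` S = Inl ` S \<union> Inr ` {}" by auto
    then show ?thesis by (simp only: line_diversity_Plus) simp
  qed
  obtain f where f: "\<forall>z\<in>?Z. f z \<in> \<Omega>" "\<forall>S\<subseteq>?Z. \<delta> (f ` S) = line_diversity \<delta> w S"
    "\<forall>y\<in>insert b E. f (?i y) = y"
  proof (rule extension[OF _ W.rational_line_diversity])
    show "finite ?Z" "finite (insert b E)" "insert b E \<subseteq> \<Omega>" using W.E W.b by auto
    show "?i y \<in> ?Z" if "y \<in> insert b E" for y using that by auto
    show "line_diversity \<delta> w (?i ` S) = \<delta> S" if "S \<subseteq> insert b E" for S using that by (rule pres)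
  qed
  show ?thesis
  proof (rule that[of "\<lambda>i. f (Inr i)"]; (intro allI impI)?)
    show "f (Inr 0) = b" using f(3) by simp
    show "f (Inr i) \<in> \<Omega>" if "i \<le> n" for i using f(1) that by blast
    show "\<delta> (T \<union> (\<lambda>i. f (Inr i)) ` I) = w T (Max I - Min I)"
      if TI: "T \<subseteq> E" "I \<subseteq> {..n}" "I \<noteq> {}" for T I
    proof -
      have "f (Inl e) = e" if "e \<in> E" for e 
        using bspec[OF f(3), of e] W.b(2) that by (cases "e = b") auto
      then have "f ` Inl ` T = T" using TI(1) by (force simp: image_image)
      then have "T \<union> (\<lambda>i. f (Inr i)) ` I = f ` (Inl ` T \<union> Inr ` I)"
        by (simp add: image_Un image_image)
      moreover have "Inl ` T \<union> Inr ` I \<subseteq> ?Z" using TI by auto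
      ultimately show ?thesis using f(2) TI(3) by (simp add: line_diversity_Plus)
    qed
  qed
qed

end

section \<open>Twins and chains of twins\<close>

text \<open>A twin of \<open>b\<close> over \<open>E\<close> is a second copy of \<open>b\<close> at distance \<open>\<epsilon>\<close> which no set that meets \<open>E\<close> can tell
  apart from \<open>b\<close>, not even when it contains both points. The last condition makes the type of
  \<open>(b, b')\<close> over \<open>E\<close> depend on \<open>\<epsilon>\<close> and on the type of \<open>b\<close> only, so that a twin over a larger set can
  stand in for any twin over \<open>E\<close>.\<close>

definition twins :: "('a set \<Rightarrow> real) \<Rightarrow> 'a set \<Rightarrow> real \<Rightarrow> 'a \<Rightarrow> 'a \<Rightarrow> bool" where
  "twins \<delta> E \<epsilon> b b' \<longleftrightarrow> \<delta> {b, b'} = \<epsilon> \<and>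
     (\<forall>T\<subseteq>E. \<delta> (insert b' T) = \<delta> (insert b T)) \<and>
     (\<forall>T\<subseteq>E. T \<noteq> {} \<longrightarrow> \<delta> (insert b (insert b' T)) = \<delta> (insert b T))"

lemma twins_mono: "twins \<delta> E \<epsilon> b b' \<Longrightarrow> F \<subseteq> E \<Longrightarrow> twins \<delta> F \<epsilon> b b'"
  unfolding twins_def by (meson order_trans)

lemma twins_same_type:
  assumes "twins \<delta> E \<epsilon> b b'" "twins \<delta> E \<epsilon> b b''" "T \<subseteq> insert b E"
  shows "\<delta> (insert b'' T) = \<delta> (insert b' T)"
proof -
  have tw: "\<delta> (insert x (insert b U)) = (if U = {} then \<epsilon> else \<delta> (insert b U))"
    if "twins \<delta> E \<epsilon> b x" "U \<subseteq> E" for x U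
    using that unfolding twins_def by (auto simp: insert_commute)
  show ?thesis
  proof (cases "b \<in> T")
    case True
    then have "T = insert b (T - {b})" "T - {b} \<subseteq> E" using assms(3) by auto
    then show ?thesis using tw[OF assms(1)] tw[OF assms(2)] by metis
  next
    case False
    then have "T \<subseteq> E" using assms(3) by blast
    then show ?thesis using assms(1,2) unfolding twins_def by simp
  qed
qed

text \<open>Put \<open>f S = \<delta> (S \<union> {b})\<close> and \<open>F T = \<delta> (T \<union> {b, b'})\<close>, and consider two points that are \<open>k\<close> steps
  apart on a chain of \<open>\<epsilon>\<close>-twins over \<open>E\<close> from \<open>b\<close> to \<open>b'\<close>. If \<open>S \<supseteq> T\<close> has at least \<open>k\<close> points, split it into
  \<open>k\<close> nonempty parts and spend one step on each. Such a step is free, since a set that meets \<open>E\<close> does not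
  distinguish twins. So subadditivity bounds the diversity of \<open>T\<close> and the two points by the sum of the
  values of \<open>f\<close> on the parts, and this sum may be as small as \<open>f S\<close>. Hence \<open>S\<close> has to allow \<open>card S\<close> free
  steps; every further one may cost \<open>\<epsilon>\<close>. This leads to \<open>f S + \<epsilon> (k - card S)\<close>, with the difference
  truncated at \<open>0\<close>. The minimum over \<open>S\<close> makes the weight monotone in \<open>T\<close>, and the cap \<open>F T\<close> lets the
  chain end in \<open>b'\<close>.\<close>

definition chain_weight ::
    "('a set \<Rightarrow> real) \<Rightarrow> 'a set \<Rightarrow> 'a \<Rightarrow> 'a \<Rightarrow> real \<Rightarrow> 'a set \<Rightarrow> nat \<Rightarrow> real" where
  "chain_weight \<delta> E b b' \<epsilon> T k =
     Min (insert (\<delta> (insert b (insert b' T)))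
       ((\<lambda>S. \<delta> (insert b S) + \<epsilon> * real (k - card S)) ` {S. T \<subseteq> S \<and> S \<subseteq> E}))"

context QD
begin

lemma delta_Stab_image:
  assumes E: "finite E" "E \<subseteq> \<Omega>" and k: "k \<in> Stab E" and T: "T \<subseteq> E" and U: "finite U" "U \<subseteq> \<Omega>"
  shows "\<delta> (k ` U \<union> T) = \<delta> (U \<union> T)"
proof -
  have "finite (U \<union> T)" "U \<union> T \<subseteq> \<Omega>" using assms finite_subset by auto
  then have "\<delta> (k ` (U \<union> T)) = \<delta> (U \<union> T)" by (rule AutD(2)[OF StabD(1)[OF k]])
  then show ?thesis by (simp only: image_Un Stab_image[OF k T])
qed

lemma twins_Stab_iff:
  assumes E: "finite E" "E \<subseteq> \<Omega>" and k: "k \<in> Stab E" and b: "b \<in> \<Omega>" "b' \<in> \<Omega>"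
  shows "twins \<delta> E \<epsilon> (k b) (k b') \<longleftrightarrow> twins \<delta> E \<epsilon> b b'"
proof -
  note inv = delta_Stab_image[OF E k]
  have "\<delta> (insert (k b) T) = \<delta> (insert b T)" "\<delta> (insert (k b') T) = \<delta> (insert b' T)"
    "\<delta> (insert (k b) (insert (k b') T)) = \<delta> (insert b (insert b' T))" if "T \<subseteq> E" for T
    using inv[OF that, of "{b}"] inv[OF that, of "{b'}"] inv[OF that, of "{b, b'}"] b by simp_all
  moreover from this(3)[of "{}"] have "\<delta> {k b, k b'} = \<delta> {b, b'}" by simp
  ultimately show ?thesis unfolding twins_def by simp
qed

text \<open>The twin is the second point of a line with two copies of \<open>b\<close>. The upper bound on \<open>\<epsilon>\<close> is
  monotonicity: the two copies have diversity \<open>\<epsilon>\<close>, and together with \<open>x\<close> they have only \<open>\<delta> {b, x}\<close>.\<close>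

lemma twin_realization:
  assumes X: "finite X" "X \<subseteq> \<Omega>" and b: "b \<in> \<Omega>" "b \<notin> X"
    and \<epsilon>: "0 < \<epsilon>" "\<epsilon> \<in> \<rat>" and far: "\<And>x. x \<in> X \<Longrightarrow> \<epsilon> \<le> \<delta> {b, x}"
  obtains b' where "b' \<in> \<Omega>" "twins \<delta> X \<epsilon> b b'"
proof -
  let ?w = "\<lambda>T (k::nat). if T = {} \<and> 0 < k then \<epsilon> else \<delta> (insert b T)"
  have fin: "finite (insert b T)" "insert b T \<subseteq> \<Omega>" if "T \<subseteq> X" for T
    using that X b finite_subset by auto
  have b0: "\<delta> {b} = 0" using diversity_eq_0_iff[OF diversity, of "{b}"] b by simp
  have le: "\<delta> (insert b S) \<le> \<delta> (insert b T)" if "S \<subseteq> T" "T \<subseteq> X" for S T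
    using that by (intro diversity_mono[OF diversity fin]) auto
  have nonneg: "0 \<le> \<delta> (insert b T)" if "T \<subseteq> X" for T using le[of "{}" T] b0 that by simp
  have far': "\<epsilon> \<le> \<delta> (insert b T)" if "T \<subseteq> X" "T \<noteq> {}" for T
  proof -
    obtain x where "x \<in> T" using \<open>T \<noteq> {}\<close> by blast
    then show ?thesis using far[of x] le[of "{x}" T] that by fastforce
  qed
  have un: "\<delta> (insert b (S \<union> T)) \<le> \<delta> (insert b S) + \<delta> (insert b T)"
    if "S \<subseteq> X" "T \<subseteq> X" for S T
    using diversity_Un_le[OF diversity fin[OF that(1)] fin[OF that(2)]] by simp
  have "line_weight \<Omega> \<delta> X b ?w"
  proof (rule line_weight.intro)
    show "?w S k \<le> ?w T l" if "S \<subseteq> T" "T \<subseteq> X" "k \<le> l" for S T k l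
      using le[OF that(1,2)] far'[OF that(2)] b0 that \<epsilon>(1) by auto
    show "?w T k \<in> \<rat>" if "T \<subseteq> X" for T k
      using \<epsilon>(2) rational fin[OF that] unfolding rational_diversity_def by auto
    show "?w (S \<union> T) (k + l) \<le> ?w S k + ?w T l" if "S \<subseteq> X" "T \<subseteq> X" for S T k l
      using un[OF that] nonneg[OF that(1)] nonneg[OF that(2)] b0 \<epsilon>(1) by auto
    show "?w (S \<union> T) k \<le> \<delta> (insert b S) + \<delta> (insert b T)"
      if "S \<subseteq> X" "T \<subseteq> X" "S \<inter> T \<noteq> {}" for S T k
      using un[OF that(1,2)] that(3) by auto
    show "?w (S \<union> T) k \<le> ?w S k + \<delta> T"
      if ST: "S \<subseteq> X" "T \<subseteq> X" "S \<inter> T \<noteq> {}" for S T k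
    proof -
      have "finite T" "T \<subseteq> \<Omega>" using X ST(2) finite_subset by auto
      then have "\<delta> (insert b S \<union> T) \<le> \<delta> (insert b S) + \<delta> T"
        using ST(3) by (intro diversity_Un_le[OF diversity fin[OF ST(1)]]) auto
      moreover have "S \<noteq> {}" using ST(3) by blast
      ultimately show ?thesis by simp
    qed
  qed (use rational X b \<epsilon> in auto)
  then obtain p where p: "p 0 = b" "\<forall>i\<le>1. p i \<in> \<Omega>"
    "\<forall>T\<subseteq>X. \<forall>I\<subseteq>{..1}. I \<noteq> {} \<longrightarrow> \<delta> (T \<union> p ` I) = ?w T (Max I - Min I)"
    by (rule line_realization[where n = 1])
  have p\<delta>: "\<delta> (T \<union> p ` I) = ?w T (Max I - Min I)"
    if "T \<subseteq> X" "I \<subseteq> {..1}" "I \<noteq> {}" for T I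
    using p(3) that by metis
  have "twins \<delta> X \<epsilon> b (p 1)"
    unfolding twins_def
  proof (intro conjI allI impI)
    show "\<delta> {b, p 1} = \<epsilon>" using p\<delta>[of "{}" "{0, 1}"] p(1) by simp
  next
    fix T assume "T \<subseteq> X"
    then show "\<delta> (insert (p 1) T) = \<delta> (insert b T)" using p\<delta>[of T "{1}"] by simp
  next
    fix T assume "T \<subseteq> X" "T \<noteq> {}"
    then show "\<delta> (insert b (insert (p 1) T)) = \<delta> (insert b T)"
      using p\<delta>[of T "{0, 1}"] p(1) by simp
  qed
  then show ?thesis using that[of "p 1"] p(2) by simp
qed

text \<open>The line with weight \<open>chain_weight\<close> has twins over \<open>E\<close> as neighbours, and if it is long enough, then its
  last point has the type of \<open>b'\<close> over \<open>E \<union> {b}\<close>, so that homogeneity moves it to \<open>b'\<close>. It is for these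
  chains that moves of \<open>b\<close> to a twin generate the stabilizer of \<open>E\<close> over that of \<open>E \<union> {b}\<close>.\<close>

lemma chain_of_twins:
  assumes E: "finite E" "E \<subseteq> \<Omega>" and b: "b \<in> \<Omega>" "b \<notin> E" "b' \<in> \<Omega>"
    and same: "\<And>T. T \<subseteq> E \<Longrightarrow> \<delta> (insert b' T) = \<delta> (insert b T)"
    and \<epsilon>: "0 < \<epsilon>" "\<epsilon> \<in> \<rat>" "\<epsilon> \<le> \<delta> {b, b'}" and far: "\<And>e. e \<in> E \<Longrightarrow> \<epsilon> \<le> \<delta> {b, e}"
  obtains p n where "p 0 = b" "p n = b'" "\<And>i. i \<le> n \<Longrightarrow> p i \<in> \<Omega>"
    "\<And>i. i < n \<Longrightarrow> twins \<delta> E \<epsilon> (p i) (p (Suc i))"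
proof -
  define f where "f S = \<delta> (insert b S)" for S
  define F where "F S = \<delta> (insert b (insert b' S))" for S
  define w where "w = chain_weight \<delta> E b b' \<epsilon>"
  have fin: "finite T" "T \<subseteq> \<Omega>" if "T \<subseteq> E" for T
    using that E finite_subset by auto
  have f0: "f {} = 0" using diversity_eq_0_iff[OF diversity, of "{b}"] b by (simp add: f_def)
  have f_mono: "f S \<le> f T" if "S \<subseteq> T" "T \<subseteq> E" for S T
    unfolding f_def using that fin[OF that(2)] b by (intro diversity_mono[OF diversity]) auto
  have F_mono: "F S \<le> F T" if "S \<subseteq> T" "T \<subseteq> E" for S T
    unfolding F_def using that fin[OF that(2)] b by (intro diversity_mono[OF diversity]) auto
  have f_le_F: "f T \<le> F T" if "T \<subseteq> E" for T
    unfolding f_def F_def using fin[OF that] b by (intro diversity_mono[OF diversity]) auto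
  have f_nonneg: "0 \<le> f T" if "T \<subseteq> E" for T using f_mono[of "{}" T] f0 that by simp
  have far': "\<epsilon> \<le> f T" if "T \<subseteq> E" "T \<noteq> {}" for T
  proof -
    obtain x where x: "x \<in> T" using \<open>T \<noteq> {}\<close> by blast
    have "\<epsilon> \<le> f {x}" using far[of x] x that(1) by (auto simp: f_def)
    also have "\<dots> \<le> f T" using x that by (intro f_mono) auto
    finally show ?thesis .
  qed
  have f_Un: "f (S \<union> T) \<le> f S + f T" if "S \<subseteq> E" "T \<subseteq> E" for S T
    using diversity_Un_le[OF diversity, of "insert b S" "insert b T"] fin[OF that(1)] fin[OF that(2)] b
    by (simp add: f_def)
  have F_Un: "F (S \<union> T) \<le> F S + f T" if "S \<subseteq> E" "T \<subseteq> E" for S T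
    using diversity_Un_le[OF diversity, of "insert b (insert b' S)" "insert b T"]
      fin[OF that(1)] fin[OF that(2)] b
    by (simp add: f_def F_def)
  have F_meet: "F (S \<union> T) \<le> f S + f T" if "S \<subseteq> E" "T \<subseteq> E" "S \<inter> T \<noteq> {}" for S T
  proof -
    have "\<delta> (insert b S \<union> insert b' T) \<le> \<delta> (insert b S) + \<delta> (insert b' T)"
      using that fin[OF that(1)] fin[OF that(2)] b by (intro diversity_Un_le[OF diversity]) auto
    moreover have "insert b S \<union> insert b' T = insert b (insert b' (S \<union> T))" by blast
    ultimately show ?thesis using same[OF that(2)] by (simp add: f_def F_def)
  qed
  have F_base: "F (S \<union> T) \<le> F S + \<delta> T" if "S \<subseteq> E" "T \<subseteq> E" "S \<inter> T \<noteq> {}" for S T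
  proof -
    have "\<delta> (insert b (insert b' S) \<union> T) \<le> \<delta> (insert b (insert b' S)) + \<delta> T"
      using that fin[OF that(1)] fin[OF that(2)] b by (intro diversity_Un_le[OF diversity]) auto
    then show ?thesis by (simp add: F_def)
  qed
  have f_base: "f (S \<union> T) \<le> f S + \<delta> T" if "S \<subseteq> E" "T \<subseteq> E" "S \<inter> T \<noteq> {}" for S T
  proof -
    have "\<delta> (insert b S \<union> T) \<le> \<delta> (insert b S) + \<delta> T"
      using that fin[OF that(1)] fin[OF that(2)] b by (intro diversity_Un_le[OF diversity]) auto
    then show ?thesis by (simp add: f_def)
  qed
  have F_le_diam: "F T \<le> f T + \<delta> {b, b'}" if "T \<subseteq> E" for T
    using F_Un[of "{}" T] that by (simp add: F_def)
  have finS: "finite {S. T \<subseteq> S \<and> S \<subseteq> E}" for T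
    by (rule finite_subset[of _ "Pow E"]) (use E(1) in auto)
  have w_le_F: "w T k \<le> F T" for T k
    unfolding w_def chain_weight_def F_def using finS by (intro Min_le) auto
  have w_le: "w T k \<le> f S + \<epsilon> * real (k - card S)" if "T \<subseteq> S" "S \<subseteq> E" for S T k
    unfolding w_def chain_weight_def f_def using finS that by (intro Min_le) auto
  have w_cases: "w T k = F T \<or> (\<exists>S. T \<subseteq> S \<and> S \<subseteq> E \<and> w T k = f S + \<epsilon> * real (k - card S))"
    for T k
  proof -
    have "w T k \<in> insert (F T) ((\<lambda>S. f S + \<epsilon> * real (k - card S)) ` {S. T \<subseteq> S \<and> S \<subseteq> E})"
      unfolding w_def chain_weight_def f_def F_def using finS by (intro Min_in) auto
    then show ?thesis by blast
  qed
  have f_le_G: "f T \<le> w T k" if "T \<subseteq> E" for T k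
    using w_cases[of T k]
  proof (elim disjE exE conjE)
    fix S assume S: "T \<subseteq> S" "S \<subseteq> E" "w T k = f S + \<epsilon> * real (k - card S)"
    have "0 \<le> \<epsilon> * real (k - card S)" using \<epsilon>(1) by simp
    then show ?thesis using f_mono[OF S(1,2)] S(3) by linarith
  qed (use f_le_F[OF that] in simp)
  have W: "line_weight \<Omega> \<delta> E b w"
  proof (rule line_weight.intro)
    show "w S k \<le> w T l" if ST: "S \<subseteq> T" "T \<subseteq> E" "k \<le> l" for S T k l
      using w_cases[of T l]
    proof (elim disjE exE conjE)
      assume "w T l = F T"
      then show ?thesis using w_le_F[of S k] F_mono[OF ST(1,2)] by linarith
    next
      fix U assume U: "T \<subseteq> U" "U \<subseteq> E" "w T l = f U + \<epsilon> * real (l - card U)"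
      have "w S k \<le> f U + \<epsilon> * real (k - card U)" using ST U by (intro w_le) auto
      also have "\<dots> \<le> f U + \<epsilon> * real (l - card U)"
        using ST(3) \<epsilon>(1) by (intro add_left_mono mult_left_mono) auto
      finally show ?thesis using U(3) by simp
    qed
    show "w T 0 = \<delta> (insert b T)" if "T \<subseteq> E" for T
      using w_le[of T T 0] f_le_G[of T 0] that by (simp add: f_def)
    show "0 < w {} 1"
      using w_cases[of "{}" 1]
    proof (elim disjE exE conjE)
      assume "w {} 1 = F {}"
      then show ?thesis using \<epsilon> by (simp add: F_def)
    next
      fix U assume U: "U \<subseteq> E" "w {} 1 = f U + \<epsilon> * real (1 - card U)"
      have "0 \<le> \<epsilon> * real (1 - card U)" using \<epsilon>(1) by simp
      then show ?thesis using U far'[OF U(1)] \<epsilon>(1) f0 by (cases "U = {}") (simp, linarith)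
    qed
    show "w T k \<in> \<rat>" if T: "T \<subseteq> E" for T k
    proof -
      have rat: "\<delta> S \<in> \<rat>" if "finite S" "S \<subseteq> \<Omega>" for S
        using rational that unfolding rational_diversity_def by blast
      show ?thesis
        using w_cases[of T k]
      proof (elim disjE exE conjE)
        assume "w T k = F T"
        then show ?thesis using rat[of "insert b (insert b' T)"] fin[OF T] b by (simp add: F_def)
      next
        fix U assume U: "U \<subseteq> E" "w T k = f U + \<epsilon> * real (k - card U)"
        then show ?thesis using rat[of "insert b U"] fin[OF U(1)] b \<epsilon>(2) by (simp add: f_def)
      qed
    qed
    show "w (S \<union> T) (k + l) \<le> w S k + w T l" if ST: "S \<subseteq> E" "T \<subseteq> E" for S T k l
    proof -
      consider "w S k = F S" | "w T l = F T"
        | U V where "S \<subseteq> U" "U \<subseteq> E" "w S k = f U + \<epsilon> * real (k - card U)"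
          "T \<subseteq> V" "V \<subseteq> E" "w T l = f V + \<epsilon> * real (l - card V)"
        using w_cases[of S k] w_cases[of T l] by blast
      then show ?thesis
      proof cases
        case 1
        have "w (S \<union> T) (k + l) \<le> F S + f T"
          using w_le_F[of "S \<union> T" "k + l"] F_Un[OF ST] by linarith
        then show ?thesis using 1 f_le_G[OF ST(2), of l] by linarith
      next
        case 2
        have "w (S \<union> T) (k + l) \<le> F T + f S"
          using w_le_F[of "S \<union> T" "k + l"] F_Un[OF ST(2,1)] by (simp add: Un_commute)
        then show ?thesis using 2 f_le_G[OF ST(1), of k] by linarith
      next
        case 3
        have nn: "0 \<le> \<epsilon> * real (k - card U)" "0 \<le> \<epsilon> * real (l - card V)" using \<epsilon>(1) by simp_all
        show ?thesis
        proof (cases "U \<inter> V = {}")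
          \<comment> \<open>Disjoint sets save the same number of steps separately as together; sets that meet are
            covered by the cap.\<close>
          case True
          have "card (U \<union> V) = card U + card V"
            using True fin(1)[OF 3(2)] fin(1)[OF 3(5)] by (intro card_Un_disjoint)
          then have "k + l - card (U \<union> V) \<le> (k - card U) + (l - card V)" by linarith
          then have "\<epsilon> * real (k + l - card (U \<union> V)) \<le> \<epsilon> * real ((k - card U) + (l - card V))"
            using \<epsilon>(1) by (intro mult_left_mono) (simp_all only: of_nat_le_iff less_imp_le)
          moreover have "w (S \<union> T) (k + l) \<le> f (U \<union> V) + \<epsilon> * real (k + l - card (U \<union> V))"
            using 3 by (intro w_le) auto
          moreover have "f (U \<union> V) \<le> f U + f V" using 3 by (intro f_Un)
          ultimately show ?thesis using 3(3,6) by (simp add: distrib_left)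
        next
          case False
          have "w (S \<union> T) (k + l) \<le> F (S \<union> T)" by (rule w_le_F)
          also have "\<dots> \<le> F (U \<union> V)" using 3 by (intro F_mono) auto
          also have "\<dots> \<le> f U + f V" using 3 False by (intro F_meet)
          finally show ?thesis using 3(3,6) nn by linarith
        qed
      qed
    qed
    show "w (S \<union> T) k \<le> \<delta> (insert b S) + \<delta> (insert b T)"
      if "S \<subseteq> E" "T \<subseteq> E" "S \<inter> T \<noteq> {}" for S T k
      using w_le_F[of "S \<union> T" k] F_meet[OF that] by (simp add: f_def)
    show "w (S \<union> T) k \<le> w S k + \<delta> T" if ST: "S \<subseteq> E" "T \<subseteq> E" "S \<inter> T \<noteq> {}" for S T k
      using w_cases[of S k]
    proof (elim disjE exE conjE)
      assume "w S k = F S"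
      then show ?thesis using w_le_F[of "S \<union> T" k] F_base[OF ST] by linarith
    next
      fix U assume U: "S \<subseteq> U" "U \<subseteq> E" "w S k = f U + \<epsilon> * real (k - card U)"
      have "w (S \<union> T) k \<le> f (U \<union> T) + \<epsilon> * real (k - card (U \<union> T))"
        using U ST by (intro w_le) auto
      also have "f (U \<union> T) \<le> f U + \<delta> T" using U ST by (intro f_base) auto
      also have "\<epsilon> * real (k - card (U \<union> T)) \<le> \<epsilon> * real (k - card U)"
      proof -
        have "card U \<le> card (U \<union> T)"
          using fin(1)[OF U(2)] fin(1)[OF ST(2)] by (intro card_mono) auto
        then show ?thesis using \<epsilon>(1) by (intro mult_left_mono) auto
      qed
      finally show ?thesis using U(3) by simp
    qed
  qed (use rational E b in auto)
  \<comment> \<open>After \<open>card E\<close> free steps and enough steps of cost \<open>\<epsilon>\<close>, only the cap \<open>F\<close> is left.\<close>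
  obtain m where m: "\<delta> {b, b'} / \<epsilon> \<le> real m" using real_arch_simple by blast
  define n where "n = card E + m"
  have w_n: "w T n = F T" if T: "T \<subseteq> E" for T
    using w_cases[of T n]
  proof (elim disjE exE conjE)
    fix S assume S: "T \<subseteq> S" "S \<subseteq> E" "w T n = f S + \<epsilon> * real (n - card S)"
    have "card S \<le> card E" using E(1) S(2) by (rule card_mono)
    then have "real m \<le> real (n - card S)" unfolding n_def by simp
    then have "\<delta> {b, b'} / \<epsilon> \<le> real (n - card S)" using m by linarith
    then have "\<delta> {b, b'} \<le> \<epsilon> * real (n - card S)"
      using \<epsilon>(1) by (simp add: pos_divide_le_eq mult.commute)
    then show ?thesis
      using S(3) F_le_diam[OF S(2)] F_mono[OF S(1,2)] w_le_F[of T n] by linarith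
  qed
  have w_1: "w T 1 = (if T = {} then \<epsilon> else f T)" if T: "T \<subseteq> E" for T
  proof (cases "T = {}")
    case True
    have "\<epsilon> \<le> w {} 1"
      using w_cases[of "{}" 1]
    proof (elim disjE exE conjE)
      fix S assume S: "S \<subseteq> E" "w {} 1 = f S + \<epsilon> * real (1 - card S)"
      have "0 \<le> \<epsilon> * real (1 - card S)" using \<epsilon>(1) by simp
      then show ?thesis using S far'[OF S(1)] f0 by (cases "S = {}") (simp, linarith)
    qed (use \<epsilon>(3) in \<open>simp add: F_def\<close>)
    then show ?thesis using w_le[of "{}" "{}" 1] f0 True by simp
  next
    case False
    then have "card T \<noteq> 0" using fin(1)[OF T] by simp
    then have "1 - card T = 0" by simp
    then have "w T 1 \<le> f T" using w_le[of T T 1] T by simp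
    then show ?thesis using f_le_G[OF T, of 1] False by simp
  qed
  obtain q where q0: "q 0 = b" and q\<Omega>: "\<forall>i\<le>n. q i \<in> \<Omega>"
    and q\<delta>: "\<forall>T\<subseteq>E. \<forall>I\<subseteq>{..n}. I \<noteq> {} \<longrightarrow> \<delta> (T \<union> q ` I) = w T (Max I - Min I)"
    by (rule line_realization[OF W, where n = n])
  have q: "q 0 = b" "\<And>i. i \<le> n \<Longrightarrow> q i \<in> \<Omega>"
    "\<And>T I. T \<subseteq> E \<Longrightarrow> I \<subseteq> {..n} \<Longrightarrow> I \<noteq> {} \<Longrightarrow> \<delta> (T \<union> q ` I) = w T (Max I - Min I)"
    using q0 q\<Omega> q\<delta> by simp_all
  \<comment> \<open>The last point of the line has the type of \<open>b'\<close> over \<open>E \<union> {b}\<close>; move it there.\<close>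
  have q_end: "\<delta> (insert b' T) = \<delta> (insert (q n) T)" if T: "T \<subseteq> insert b E" for T
  proof (cases "b \<in> T")
    case True
    have T': "T - {b} \<subseteq> E" using T by blast
    have "(T - {b}) \<union> q ` {0, n} = insert (q n) T" using True q(1) by auto
    then have "\<delta> (insert (q n) T) = F (T - {b})" using q(3)[OF T', of "{0, n}"] w_n[OF T'] by simp
    also have "\<dots> = \<delta> (insert b' (insert b (T - {b})))" by (simp only: F_def insert_commute)
    also have "insert b (T - {b}) = T" using True by blast
    finally show ?thesis by simp
  next
    case False
    then have T': "T \<subseteq> E" using T by blast
    show ?thesis
      using q(3)[OF T', of "{n}"] w_le[of T T 0] f_le_G[OF T', of 0] same[OF T'] T'
      by (simp add: f_def)
  qed
  obtain g where g: "g \<in> Stab (insert b E)" "g (q n) = b'"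
    using move_point[of "insert b E" "q n" b'] q_end E b q(2)[of n] by auto
  have gE: "g ` T = T" if "T \<subseteq> E" for T
    using StabD(2)[OF g(1)] that by (force simp: image_iff)
  have gd: "\<delta> (T \<union> (\<lambda>i. g (q i)) ` I) = w T (Max I - Min I)"
    if TI: "T \<subseteq> E" "I \<subseteq> {..n}" "I \<noteq> {}" for T I
  proof -
    have "finite (T \<union> q ` I)" "T \<union> q ` I \<subseteq> \<Omega>"
      using fin[OF TI(1)] finite_subset[OF TI(2)] q(2) TI(2) by auto
    then have "\<delta> (g ` (T \<union> q ` I)) = \<delta> (T \<union> q ` I)" by (rule AutD(2)[OF StabD(1)[OF g(1)]])
    then show ?thesis using q(3)[OF TI] gE[OF TI(1)] by (simp add: image_Un image_image)
  qed
  have sing: "\<delta> (insert (g (q i)) T) = f T" if "T \<subseteq> E" "i \<le> n" for T i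
    using gd[OF that(1), of "{i}"] that w_le[of T T 0] f_le_G[OF that(1), of 0] by simp
  have pair: "\<delta> (insert (g (q i)) (insert (g (q (Suc i))) T)) = (if T = {} then \<epsilon> else f T)"
    if "T \<subseteq> E" "i < n" for T i
    using gd[OF that(1), of "{i, Suc i}"] that w_1[OF that(1)] by simp
  show ?thesis
  proof (rule that[of "\<lambda>i. g (q i)" n])
    show "g (q 0) = b" using StabD(2)[OF g(1)] q(1) by simp
    show "g (q n) = b'" by (rule g(2))
    show "g (q i) \<in> \<Omega>" if "i \<le> n" for i using AutD(1)[OF StabD(1)[OF g(1)]] q(2)[OF that] .
    show "twins \<delta> E \<epsilon> (g (q i)) (g (q (Suc i)))" if i: "i < n" for i
      unfolding twins_def
    proof (intro conjI allI impI)
      show "\<delta> {g (q i), g (q (Suc i))} = \<epsilon>" using pair[of "{}" i] i by simp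
    qed (use sing pair i in simp_all)
  qed
qed

end

section \<open>Projections in a unitary representation\<close>

locale QD_rep = QD \<Omega> \<delta> for \<Omega> :: "'a set" and \<delta> +
  fixes \<pi> :: "('a \<Rightarrow> 'a) \<Rightarrow> 'h::complex_hilbert \<Rightarrow> 'h"
  assumes hom: "\<pi> \<in> hom Aut unitary_group"
begin

abbreviation "Fix \<equiv> fixed_vectors Aut \<pi>"
abbreviation "proj E \<equiv> orth_proj (Fix E)"

lemma FixD: "\<xi> \<in> Fix E \<Longrightarrow> g \<in> Stab E \<Longrightarrow> \<pi> g \<xi> = \<xi>"
  by (simp add: fixed_vectors_def)

lemma FixI: "(\<And>g. g \<in> Stab E \<Longrightarrow> \<pi> g \<xi> = \<xi>) \<Longrightarrow> \<xi> \<in> Fix E"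
  by (simp add: fixed_vectors_def)

lemma Stab_insertI: "g \<in> Stab E \<Longrightarrow> g b = b \<Longrightarrow> g \<in> Stab (insert b E)"
  by (simp add: pointwise_stabilizer_def)

lemma Fix_mono: "E \<subseteq> F \<Longrightarrow> Fix E \<subseteq> Fix F"
  using Stab_mono[of E F] by (auto simp: fixed_vectors_def)

lemma unitary_pi: "g \<in> carrier Aut \<Longrightarrow> unitary (\<pi> g)"
  by (rule hom_unitary_groupD(1)[OF hom])

lemma pi_mult: "g \<in> carrier Aut \<Longrightarrow> h \<in> carrier Aut \<Longrightarrow> \<pi> (g \<otimes>\<^bsub>Aut\<^esub> h) \<xi> = \<pi> g (\<pi> h \<xi>)"
  by (rule hom_unitary_groupD(2)[OF hom])

lemmas linear_pi = linear_unitary[OF unitary_pi]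
lemmas norm_pi = norm_unitary[OF unitary_pi]

lemma Fix_diff:
  assumes "\<xi> \<in> Fix E" "\<eta> \<in> Fix E"
  shows "\<xi> - \<eta> \<in> Fix E"
  using assms by (auto intro!: FixI simp: FixD linear_diff[OF linear_pi[OF StabD(1)]])

lemma
  assumes E: "E \<subseteq> \<Omega>"
  shows proj_in_Fix: "proj E \<xi> \<in> Fix E"
    and proj_orth: "\<zeta> \<in> Fix E \<Longrightarrow> cinner (\<xi> - proj E \<xi>) \<zeta> = 0"
    and proj_in_orbit_hull: "proj E \<xi> \<in> closure (convex hull ((\<lambda>g. \<pi> g \<xi>) ` Stab E))"
proof -
  obtain \<eta> where \<eta>: "\<forall>g\<in>Stab E. \<pi> g \<eta> = \<eta>"
    "\<eta> \<in> closure (convex hull ((\<lambda>g. \<pi> g \<xi>) ` Stab E))"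
    "\<And>\<zeta>. \<forall>g\<in>Stab E. \<pi> g \<zeta> = \<zeta> \<Longrightarrow> cinner (\<xi> - \<eta>) \<zeta> = 0"
    using exists_projection_in_orbit_hull[OF Aut.is_group hom subgroup_Stab[OF E]] by blast
  have "\<eta> \<in> Fix E" "\<And>\<zeta>. \<zeta> \<in> Fix E \<Longrightarrow> cinner (\<xi> - \<eta>) \<zeta> = 0"
    using \<eta>(1,3) by (auto simp: fixed_vectors_def)
  moreover from this have "proj E \<xi> = \<eta>" by (intro orth_proj_eqI Fix_diff)
  ultimately show "proj E \<xi> \<in> Fix E" "\<zeta> \<in> Fix E \<Longrightarrow> cinner (\<xi> - proj E \<xi>) \<zeta> = 0"
    "proj E \<xi> \<in> closure (convex hull ((\<lambda>g. \<pi> g \<xi>) ` Stab E))"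
    using \<eta>(2) by simp_all
qed

lemma proj_eqI:
  assumes "\<eta> \<in> Fix E" "\<And>\<zeta>. \<zeta> \<in> Fix E \<Longrightarrow> cinner (\<xi> - \<eta>) \<zeta> = 0"
  shows "proj E \<xi> = \<eta>"
  using assms by (intro orth_proj_eqI Fix_diff)

text \<open>The coset of \<open>g\<close> modulo the stabilizer of \<open>E \<union> {b}\<close> is determined by \<open>g b\<close>.\<close>

lemma pi_eq_of_same_point:
  assumes E: "E \<subseteq> \<Omega>" "b \<in> \<Omega>" and \<eta>: "\<eta> \<in> Fix (insert b E)"
    and g: "g \<in> Stab E" "h \<in> Stab E" "g b = h b"
  shows "\<pi> g \<eta> = \<pi> h \<eta>"
proof -
  interpret S: subgroup "Stab E" Aut by (rule subgroup_Stab[OF E(1)])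
  note c = StabD(1)[OF g(1)] StabD(1)[OF g(2)]
  let ?k = "inv\<^bsub>Aut\<^esub> h \<otimes>\<^bsub>Aut\<^esub> g"
  have "?k \<in> Stab E" using g by simp
  moreover have "?k b = b"
    using c E(2) g(3) by (simp add: mult_apply inv_apply)
  ultimately have "?k \<in> Stab (insert b E)" by (rule Stab_insertI)
  then have "\<pi> h (\<pi> ?k \<eta>) = \<pi> h \<eta>" using FixD[OF \<eta>] by simp
  moreover have "\<pi> h (\<pi> ?k \<eta>) = \<pi> g \<eta>"
    using c pi_mult[of h ?k] by (simp flip: Aut.m_assoc)
  ultimately show ?thesis by simp
qed

lemma pi_in_Fix_image:
  assumes A: "A \<subseteq> \<Omega>" and \<xi>: "\<xi> \<in> Fix A" and k: "k \<in> carrier Aut"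
  shows "\<pi> k \<xi> \<in> Fix (k ` A)"
proof (rule FixI)
  fix h assume h: "h \<in> Stab (k ` A)"
  note c = StabD(1)[OF h] k
  let ?k = "inv\<^bsub>Aut\<^esub> k \<otimes>\<^bsub>Aut\<^esub> (h \<otimes>\<^bsub>Aut\<^esub> k)"
  have "?k a = a" if a: "a \<in> A" for a
  proof -
    have a\<Omega>: "a \<in> \<Omega>" using a A by blast
    have "?k a = (inv\<^bsub>Aut\<^esub> k) (h (k a))"
      using c a\<Omega> by (simp add: mult_apply)
    then show ?thesis using StabD(2)[OF h, of "k a"] a inv_apply[OF k a\<Omega>] by simp
  qed
  then have "?k \<in> Stab A" using c by (simp add: pointwise_stabilizer_def)
  then have "\<pi> k (\<pi> ?k \<xi>) = \<pi> k \<xi>" using FixD[OF \<xi>] by simp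
  moreover have "\<pi> k (\<pi> ?k \<xi>) = \<pi> h (\<pi> k \<xi>)"
    using c pi_mult[of k ?k] pi_mult[of h k] by (simp flip: Aut.m_assoc)
  ultimately show "\<pi> h (\<pi> k \<xi>) = \<pi> k \<xi>" by simp
qed

definition far_sets :: "'a set \<Rightarrow> 'a \<Rightarrow> real \<Rightarrow> 'a set set" where
  "far_sets E b c = {X. finite X \<and> X \<subseteq> \<Omega> \<and> E \<subseteq> X \<and> (\<forall>x\<in>X. c \<le> \<delta> {b, x})}"

text \<open>The projection of \<open>\<xi>\<close> is a limit of convex combinations of finitely many translates of \<open>\<xi>\<close> by elements
  that fix \<open>b\<close> and \<open>E\<close>. Such a combination is fixed by the stabilizer of the union of \<open>E\<close> and of
  finitely many translates of \<open>A\<close>, all of which are exactly as far from \<open>b\<close> as \<open>A\<close> is. It is this bound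
  \<open>c\<close>, uniform over all degrees of approximation, that makes the argument work.\<close>

lemma proj_approx_far_sets:
  assumes A: "finite A" "A \<subseteq> \<Omega>" and E: "finite E" "E \<subseteq> \<Omega>" and b: "b \<in> \<Omega>"
    and far: "\<And>x. x \<in> A \<union> E \<Longrightarrow> c \<le> \<delta> {b, x}"
    and \<xi>: "\<xi> \<in> Fix A"
  shows "proj (insert b E) \<xi> \<in> closure (\<Union>X\<in>far_sets E b c. Fix X)"
proof -
  let ?V = "\<Union>X\<in>far_sets E b c. Fix X"
  have "convex ?V"
  proof (rule convexI)
    fix v w and s t :: real assume "v \<in> ?V" "w \<in> ?V"
    then obtain X Y where XY: "X \<in> far_sets E b c" "Y \<in> far_sets E b c" and vw: "v \<in> Fix X" "w \<in> Fix Y"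
      by blast
    have "v \<in> Fix (X \<union> Y)" "w \<in> Fix (X \<union> Y)"
      using vw Fix_mono[of X "X \<union> Y"] Fix_mono[of Y "X \<union> Y"] by auto
    then have "s *\<^sub>R v + t *\<^sub>R w \<in> Fix (X \<union> Y)"
      by (auto intro!: FixI simp: FixD linear_add[OF linear_pi[OF StabD(1)]]
          linear_scale[OF linear_pi[OF StabD(1)]])
    moreover have "X \<union> Y \<in> far_sets E b c" using XY by (auto simp: far_sets_def)
    ultimately show "s *\<^sub>R v + t *\<^sub>R w \<in> ?V" by blast
  qed
  moreover have "\<pi> k \<xi> \<in> ?V" if k: "k \<in> Stab (insert b E)" for k
  proof -
    note kc = StabD(1)[OF k]
    have "c \<le> \<delta> {b, k a}" if "a \<in> A" for a
    proof -
      have "a \<in> \<Omega>" using A that by blast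
      then have "\<delta> (k ` {b, a}) = \<delta> {b, a}" using b by (intro AutD(2)[OF kc]) auto
      then show ?thesis using far[of a] StabD(2)[OF k, of b] that by simp
    qed
    then have "E \<union> k ` A \<in> far_sets E b c"
      using A E far AutD(1)[OF kc] by (auto simp: far_sets_def)
    moreover have "\<pi> k \<xi> \<in> Fix (E \<union> k ` A)"
      using pi_in_Fix_image[OF A(2) \<xi> kc] Fix_mono[of "k ` A" "E \<union> k ` A"] by blast
    ultimately show ?thesis by blast
  qed
  ultimately have "convex hull ((\<lambda>g. \<pi> g \<xi>) ` Stab (insert b E)) \<subseteq> ?V"
    by (intro hull_minimal) auto
  then show ?thesis
    using proj_in_orbit_hull[of "insert b E" \<xi>] E b closure_mono by blast
qed

text \<open>Approximate \<open>\<eta>\<close> by a vector \<open>v\<close> that is fixed by the stabilizer of a set \<open>X\<close> far from \<open>b\<close>. There is an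
  \<open>\<epsilon>\<close>-twin of \<open>b\<close> even over \<open>X\<close>, hence some \<open>k\<close> that fixes \<open>X\<close>, and with it \<open>v\<close>, and that moves \<open>b\<close> to this
  twin. So \<open>k\<close> almost fixes \<open>\<eta>\<close>. But \<open>\<parallel>\<pi> h \<eta> - \<eta>\<parallel>\<close> depends only on the type of \<open>(b, h b)\<close> over \<open>E\<close>,
  which does not involve \<open>X\<close>: it is the same for \<open>h\<close> and \<open>k\<close>, hence \<open>0\<close>.\<close>

lemma twin_moves_fix:
  assumes E: "finite E" "E \<subseteq> \<Omega>" and b: "b \<in> \<Omega>"
    and \<eta>: "\<eta> \<in> Fix (insert b E)" "\<eta> \<in> closure (\<Union>X\<in>far_sets E b c. Fix X)"
    and \<epsilon>: "0 < \<epsilon>" "\<epsilon> \<in> \<rat>" "\<epsilon> \<le> c"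
    and h: "h \<in> Stab E" "twins \<delta> E \<epsilon> b (h b)"
  shows "\<pi> h \<eta> = \<eta>"
proof -
  note hc = StabD(1)[OF h(1)]
  have "norm (\<pi> h \<eta> - \<eta>) \<le> 2 * e" if e: "0 < e" for e
  proof -
    obtain v X where X: "X \<in> far_sets E b c" and v: "v \<in> Fix X" "norm (\<eta> - v) < e"
      using \<eta>(2) e unfolding closure_approachable by (auto simp: dist_norm norm_minus_commute)
    have X': "finite X" "X \<subseteq> \<Omega>" "E \<subseteq> X" "\<And>x. x \<in> X \<Longrightarrow> \<epsilon> \<le> \<delta> {b, x}"
      using X \<epsilon>(3) by (auto simp: far_sets_def)
    have "b \<notin> X"
    proof
      assume "b \<in> X"
      then have "\<epsilon> \<le> \<delta> {b}" using X'(4)[of b] by simp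
      then show False using \<epsilon>(1) diversity_eq_0_iff[OF diversity, of "{b}"] b by simp
    qed
    then obtain b'' where b'': "b'' \<in> \<Omega>" "twins \<delta> X \<epsilon> b b''"
      using twin_realization[OF X'(1,2) b _ \<epsilon>(1,2) X'(4)] by blast
    then obtain k where k: "k \<in> Stab X" "k b = b''"
      using move_point[OF X'(1,2) b b''(1)] unfolding twins_def by blast
    have "\<And>T. T \<subseteq> insert b E \<Longrightarrow> \<delta> (insert b'' T) = \<delta> (insert (h b) T)"
      using twins_same_type[OF h(2) twins_mono[OF b''(2) X'(3)]] by blast
    then obtain u where u: "u \<in> Stab (insert b E)" "u (h b) = b''"
      using move_point[of "insert b E" "h b" b''] E b b''(1) AutD(1)[OF hc b] by auto
    note kc = StabD(1)[OF k(1)] and uc = StabD(1)[OF u(1)]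
    have "u \<otimes>\<^bsub>Aut\<^esub> h \<in> Stab E"
      using u h hc uc E(2) by (auto simp: pointwise_stabilizer_def mult_apply subset_iff)
    moreover have "k \<in> Stab E" using k(1) Stab_mono[OF X'(3)] by blast
    moreover have "(u \<otimes>\<^bsub>Aut\<^esub> h) b = k b" using u(2) k(2) b uc hc by (simp add: mult_apply)
    ultimately have "\<pi> (u \<otimes>\<^bsub>Aut\<^esub> h) \<eta> = \<pi> k \<eta>"
      by (intro pi_eq_of_same_point[OF E(2) b \<eta>(1)])
    then have "\<pi> u (\<pi> h \<eta>) = \<pi> k \<eta>" using pi_mult uc hc by simp
    moreover have "\<pi> u \<eta> = \<eta>" using \<eta>(1) u(1) by (rule FixD)
    ultimately have "\<pi> u (\<pi> h \<eta> - \<eta>) = \<pi> k \<eta> - \<eta>" by (simp add: linear_diff[OF linear_pi[OF uc]])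
    then have "norm (\<pi> h \<eta> - \<eta>) = norm (\<pi> k \<eta> - \<eta>)" using norm_pi[OF uc] by metis
    also have "\<pi> k \<eta> - \<eta> = \<pi> k (\<eta> - v) - (\<eta> - v)"
      using FixD[OF v(1) k(1)] by (simp add: linear_diff[OF linear_pi[OF kc]])
    also have "norm \<dots> \<le> norm (\<eta> - v) + norm (\<eta> - v)"
      using norm_triangle_ineq4[of "\<pi> k (\<eta> - v)" "\<eta> - v"] norm_pi[OF kc] by simp
    finally show ?thesis using v(2) by simp
  qed
  from this[of "norm (\<pi> h \<eta> - \<eta>) / 4"] show ?thesis by (cases "\<pi> h \<eta> = \<eta>") auto
qed

text \<open>The heart of the matter: a point \<open>b\<close> outside \<open>A\<close> can be dropped. By \<open>twin_moves_fix\<close> the projection is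
  fixed by every element of the stabilizer of \<open>E\<close> that moves \<open>b\<close> to a close twin, and by
  \<open>chain_of_twins\<close> every element of this stabilizer agrees at \<open>b\<close> with a product of such elements.\<close>

lemma proj_in_Fix_remove_point:
  assumes A: "finite A" "A \<subseteq> \<Omega>" and E: "finite E" "E \<subseteq> \<Omega>" and b: "b \<in> \<Omega>" "b \<notin> A \<union> E"
    and \<xi>: "\<xi> \<in> Fix A"
  shows "proj (insert b E) \<xi> \<in> Fix E"
proof (rule FixI)
  fix g assume g: "g \<in> Stab E"
  note gc = StabD(1)[OF g]
  let ?\<eta> = "proj (insert b E) \<xi>"
  have "insert b E \<subseteq> \<Omega>" using E(2) b(1) by simp
  then have \<eta>: "?\<eta> \<in> Fix (insert b E)" by (rule proj_in_Fix)
  \<comment> \<open>The \<open>1\<close> serves the case in which \<open>A\<close> and \<open>E\<close> are empty.\<close>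
  define c where "c = Min (insert 1 ((\<lambda>x. \<delta> {b, x}) ` (A \<union> E)))"
  have rat: "\<delta> {b, x} \<in> \<rat>" and pos: "0 < \<delta> {b, x} \<or> x = b" if "x \<in> \<Omega>" for x
  proof -
    have bx: "finite {b, x}" "{b, x} \<subseteq> \<Omega>" using b that by auto
    then show "\<delta> {b, x} \<in> \<rat>" using rational unfolding rational_diversity_def by blast
    have "\<delta> {b} \<le> \<delta> {b, x}" using bx by (intro diversity_mono[OF diversity]) auto
    moreover have "\<delta> {b} = 0" using diversity_eq_0_iff[OF diversity, of "{b}"] b by simp
    moreover have "\<delta> {b, x} = 0 \<longleftrightarrow> card {b, x} \<le> 1" by (rule diversity_eq_0_iff[OF diversity bx])
    ultimately show "0 < \<delta> {b, x} \<or> x = b" by (cases "x = b") auto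
  qed
  have "c \<in> insert 1 ((\<lambda>x. \<delta> {b, x}) ` (A \<union> E))" unfolding c_def using A E by (intro Min_in) auto
  then have c: "0 < c" "c \<in> \<rat>" using rat pos A E b(2) by auto
  have far: "c \<le> \<delta> {b, x}" if "x \<in> A \<union> E" for x
    unfolding c_def using A E that by (intro Min_le) auto
  have approx: "?\<eta> \<in> closure (\<Union>X\<in>far_sets E b c. Fix X)"
    using A E b(1) far \<xi> by (rule proj_approx_far_sets)
  show "\<pi> g ?\<eta> = ?\<eta>"
  proof (cases "g b = b")
    case True
    with g have "g \<in> Stab (insert b E)" by (rule Stab_insertI)
    then show ?thesis by (rule FixD[OF \<eta>])
  next
    case False
    have gb: "g b \<in> \<Omega>" by (rule AutD(1)[OF gc b(1)])
    define \<epsilon> where "\<epsilon> = min c (\<delta> {b, g b})"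
    have \<epsilon>: "0 < \<epsilon>" "\<epsilon> \<in> \<rat>" "\<epsilon> \<le> \<delta> {b, g b}" "\<epsilon> \<le> c"
      using c rat[OF gb] pos[OF gb] False by (auto simp: \<epsilon>_def min_def)
    obtain p n where p: "p 0 = b" "p n = g b" "\<And>i. i \<le> n \<Longrightarrow> p i \<in> \<Omega>"
      "\<And>i. i < n \<Longrightarrow> twins \<delta> E \<epsilon> (p i) (p (Suc i))"
    proof (rule chain_of_twins[OF E b(1) _ gb _ \<epsilon>(1-3)])
      show "b \<notin> E" using b(2) by blast
      show "\<delta> (insert (g b) T) = \<delta> (insert b T)" if "T \<subseteq> E" for T
        using delta_Stab_image[OF E g that, of "{b}"] b(1) by simp
      show "\<epsilon> \<le> \<delta> {b, e}" if "e \<in> E" for e using far[of e] \<epsilon>(4) that by simp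
    qed blast
    \<comment> \<open>Walk along the chain; each step is pulled back to a step that starts at \<open>b\<close>.\<close>
    have "\<exists>k\<in>Stab E. k b = p i \<and> \<pi> k ?\<eta> = ?\<eta>" if "i \<le> n" for i
      using that
    proof (induction i)
      case 0
      have "\<one>\<^bsub>Aut\<^esub> \<in> Stab (insert b E)"
        using subgroup.one_closed[OF subgroup_Stab] E(2) b(1) by simp
      then show ?case using FixD[OF \<eta>] Stab_mono[of E "insert b E"] StabD(2)[of _ "insert b E" b] p(1)
        by blast
    next
      case (Suc i)
      then obtain k where k: "k \<in> Stab E" "k b = p i" "\<pi> k ?\<eta> = ?\<eta>" by auto
      note kc = StabD(1)[OF k(1)]
      interpret S: subgroup "Stab E" Aut by (rule subgroup_Stab[OF E(2)])
      have k': "inv\<^bsub>Aut\<^esub> k \<in> Stab E" using k(1) by simp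
      define b' where "b' = (inv\<^bsub>Aut\<^esub> k) (p (Suc i))"
      have p\<Omega>: "p i \<in> \<Omega>" "p (Suc i) \<in> \<Omega>" using p(3) Suc.prems by auto
      have b'\<Omega>: "b' \<in> \<Omega>" unfolding b'_def by (rule AutD(1)[OF StabD(1)[OF k'] p\<Omega>(2)])
      have kb': "k b' = p (Suc i)"
        using inv_apply[OF StabD(1)[OF k'] p\<Omega>(2)] kc by (simp add: b'_def)
      have tw: "twins \<delta> E \<epsilon> b b'"
        using p(4)[of i] Suc.prems twins_Stab_iff[OF E k(1) b(1) b'\<Omega>] k(2) kb' by simp
      have "\<And>T. T \<subseteq> E \<Longrightarrow> \<delta> (insert b' T) = \<delta> (insert b T)" using tw unfolding twins_def by blast
      then obtain h where h: "h \<in> Stab E" "h b = b'"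
        using move_point[OF E b(1) b'\<Omega>] by blast
      have "\<pi> h ?\<eta> = ?\<eta>"
        using twin_moves_fix[OF E b(1) \<eta> approx \<epsilon>(1,2,4) h(1)] tw h(2) by simp
      then have "\<pi> (k \<otimes>\<^bsub>Aut\<^esub> h) ?\<eta> = ?\<eta>" using pi_mult kc StabD(1)[OF h(1)] k(3) by simp
      moreover have "(k \<otimes>\<^bsub>Aut\<^esub> h) b = p (Suc i)"
        using mult_apply[OF kc StabD(1)[OF h(1)] b(1)] h(2) kb' by simp
      moreover have "k \<otimes>\<^bsub>Aut\<^esub> h \<in> Stab E" using k(1) h(1) by simp
      ultimately show ?case by blast
    qed
    from this[of n] obtain k where k: "k \<in> Stab E" "k b = g b" "\<pi> k ?\<eta> = ?\<eta>" using p(2) by auto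
    then show ?thesis using pi_eq_of_same_point[OF E(2) b(1) \<eta> g k(1)] by simp
  qed
qed

text \<open>Drop the points of \<open>D\<close> one at a time. After each step the projection lies in the smaller space of
  fixed vectors, so it is also the projection onto that space.\<close>

lemma proj_in_Fix_Int:
  assumes A: "finite A" "A \<subseteq> \<Omega>" and C: "C \<subseteq> A" and \<xi>: "\<xi> \<in> Fix A"
    and "finite D" "D \<subseteq> \<Omega>" "D \<inter> A = {}"
  shows "proj (C \<union> D) \<xi> \<in> Fix C"
  using assms(5-)
proof (induction D rule: finite_induct)
  case empty
  then show ?case using proj_in_Fix[of C] A C by auto
next
  case (insert b D)
  let ?E = "C \<union> D"
  have E: "finite ?E" "?E \<subseteq> \<Omega>" and b: "b \<in> \<Omega>" "b \<notin> A \<union> ?E"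
    using insert A C finite_subset by auto
  have mem: "proj (insert b ?E) \<xi> \<in> Fix ?E"
    by (rule proj_in_Fix_remove_point[OF A E b \<xi>])
  have "proj ?E \<xi> = proj (insert b ?E) \<xi>"
  proof (rule proj_eqI[OF mem])
    fix \<zeta> assume "\<zeta> \<in> Fix ?E"
    then have "\<zeta> \<in> Fix (insert b ?E)" using Fix_mono[of ?E "insert b ?E"] by blast
    then show "cinner (\<xi> - proj (insert b ?E) \<xi>) \<zeta> = 0"
      using proj_orth[of "insert b ?E"] E b by simp
  qed
  then show ?case using insert by simp
qed

lemma proj_comp_proj:
  assumes A: "finite A" "A \<subseteq> \<Omega>" and B: "finite B" "B \<subseteq> \<Omega>"
  shows "proj A (proj B \<xi>) = proj (A \<inter> B) \<xi>"
proof -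
  let ?\<eta> = "proj A (proj B \<xi>)"
  have "proj (A \<inter> B \<union> (A - B)) (proj B \<xi>) \<in> Fix (A \<inter> B)"
    using A B proj_in_Fix[OF B(2)] by (intro proj_in_Fix_Int[of B]) auto
  moreover have "A \<inter> B \<union> (A - B) = A" by blast
  ultimately have "?\<eta> \<in> Fix (A \<inter> B)" by simp
  then have "proj (A \<inter> B) \<xi> = ?\<eta>"
  proof (rule proj_eqI)
    fix \<zeta> assume "\<zeta> \<in> Fix (A \<inter> B)"
    then have "\<zeta> \<in> Fix A" "\<zeta> \<in> Fix B" using Fix_mono[of "A \<inter> B"] by auto
    then have "cinner (\<xi> - proj B \<xi>) \<zeta> = 0" "cinner (proj B \<xi> - ?\<eta>) \<zeta> = 0"
      using proj_orth A(2) B(2) by auto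
    then show "cinner (\<xi> - ?\<eta>) \<zeta> = 0" by (simp add: cinner_diff_left)
  qed
  then show ?thesis by simp
qed

end

theorem theorem5p24:
  fixes \<Omega> :: "'a set" and \<delta> :: "'a set \<Rightarrow> real"
  assumes "QD_limit \<Omega> \<delta>"
  shows "dissociated TYPE('h::complex_hilbert) \<Omega> (diversity_Aut \<Omega> \<delta>)"
  unfolding dissociated_def dissociated_rep_def
proof (intro allI impI)
  fix \<pi> :: "('a \<Rightarrow> 'a) \<Rightarrow> 'h \<Rightarrow> 'h" and A B
  assume rep: "unitary_rep \<Omega> (diversity_Aut \<Omega> \<delta>) \<pi>"
    and AB: "finite A \<and> A \<subseteq> \<Omega> \<and> finite B \<and> B \<subseteq> \<Omega>"
  interpret QD_rep \<Omega> \<delta> \<pi>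
    using assms rep by unfold_locales (auto simp: unitary_rep_def)
  show "proj A \<circ> proj B = proj (A \<inter> B)"
    using AB proj_comp_proj by (auto simp: fun_eq_iff)
qed

end
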